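(* Let $L\ge1$, let $\omega_1,\ldots,\omega_L\in\mathbb C\setminus\{0\}$, and let $D_1>0$, $R>1$. Suppose that the vector field $\mathbf g:\mathbb R\times\mathbb C^d\to\mathbb C^d$ has the form $$\mathbf g(t,\mathbf x)=\sum_{\boldsymbol\alpha_1,\ldots,\boldsymbol\alpha_L\in\mathbb Z^d}\mathbf g_{\boldsymbol\alpha_1,\ldots,\boldsymbol\alpha_L}(t)\,e^{i\sum_{l=1}^L\omega_l\boldsymbol\alpha_l\mathbf x}$$ with coefficients $\mathbf g_{\boldsymbol\alpha_1,\ldots,\boldsymbol\alpha_L}(t)=[g_{1,\boldsymbol\alpha_1,\ldots,\boldsymbol\alpha_L}(t),\ldots,g_{d,\boldsymbol\alpha_1,\ldots,\boldsymbol\alpha_L}(t)]^T$ satisfying $$\sup_{t\ge0}\sum_{j'=1}^d\ \sum_{|\boldsymbol\alpha_1|+\cdots+|\boldsymbol\alpha_L|=k}|g_{j',\boldsymbol\alpha_1,\ldots,\boldsymbol\alpha_L}(t)|\le\frac{D_1}{2\big(\sum_{l=1}^L|\omega_l|\big)R^k},\qquad k\ge0 .$$ Let $\mathbf x(t)=[x_1(t),\ldots,x_d(t)]^T$ be the solution of $\dot{\mathbf x}=\mathbf g(t,\mathbf x)$, $t\ge0$, with initial state $\mathbf x(0)=\mathbf x_0=[x_{0,1},\ldots,x_{0,d}]^T\in\mathbb C^d$ satisfying $$\max_{1\le l\le L}\max_{1\le j\le d}|\Im(\omega_lx_{0,j})|<\ln R-1 .$$ For $N\ge1$ let $\tilde{\mathbf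 v}_{1,N}(t)=[\tilde v_{1,N}(t),\ldots,\tilde v_{2dL,N}(t)]^T$ be the first block of the finite-section approximation of order $N$ of the Carleman-Fourier linearization of the extended system (defined in the context). Set $$\tilde T_{CF}=\frac{e-1}{D_1(2e-1)}\Big(\ln R-1-\max_{1\le l\le L}\max_{1\le j\le d}|\Im(\omega_lx_{0,j})|\Big)$$ and $$C_1=\frac{1}{\sqrt{2\pi}(e-1)}\exp\Big(\frac{3e-1}{2e-1}\ln R+\frac{e-1}{2e-1}\max_{1\le l\le L}\max_{1\le j\le d}|\Im(\omega_lx_{0,j})|-\frac{e}{2e-1}\Big)\le\frac{R^2}{\sqrt{2\pi}\,e(e-1)} .$$ Then for every $N\ge1$, $$\Big|\tilde v_{j'+d(l-1)+mdL,N}(t)\,e^{-i(-1)^m\omega_lx_{j'}(t)}-1\Big|\le C_1N^{-3/2}e^{D_1(t-\tilde T_{CF})N}$$ for all $m\in\{0,1\}$, $1\le l\le L$, $1\le j'\le d$ and $0\le t\le\tilde T_{CF}$.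
   Context: Notation: for $n\ge1$, $\mathbb Z_+^n$ is the set of $n$-tuples of nonnegative integers and $\mathbb Z_{+,k}^n=\{\boldsymbol\gamma\in\mathbb Z_+^n:|\boldsymbol\gamma|=k\}$, where $|\boldsymbol\gamma|=\sum_j|\gamma_j|$; $\boldsymbol\gamma\mathbf y=\sum_j\gamma_jy_j$. For $\boldsymbol\alpha\in\mathbb Z^d$, $\boldsymbol\alpha_+=[\max(\alpha_1,0),\ldots,\max(\alpha_d,0)]^T$ and $\boldsymbol\alpha_-=\boldsymbol\alpha_+-\boldsymbol\alpha$, both in $\mathbb Z_+^d$. $\Im$ denotes imaginary part. Extended system: let $\tilde{\mathbf x}=[\omega_1\mathbf x^T,\ldots,\omega_L\mathbf x^T,-\omega_1\mathbf x^T,\ldots,-\omega_L\mathbf x^T]^T\in\mathbb C^{2dL}$ and $\tilde{\mathbf x}_0=[\omega_1\mathbf x_0^T,\ldots,\omega_L\mathbf x_0^T,-\omega_1\mathbf x_0^T,\ldots,-\omega_L\mathbf x_0^T]^T$. For $\boldsymbol\gamma\in\mathbb Z^{2dL}$ define $\tilde{\mathbf g}_{\boldsymbol\gamma}(t)=[\tilde g_{1,\boldsymbol\gamma}(t),\ldots,\tilde g_{2dL,\boldsymbol\gamma}(t)]^T$ as follows: if $\boldsymbol\gamma=[(\boldsymbol\alpha_1)_+^T,\ldots,(\boldsymbol\alpha_L)_+^T,(\boldsymbol\alpha_1)_-^T,\ldots,(\boldsymbol\alpha_L)_-^T]^T$ for some $\boldsymbol\alpha_1,\ldots,\boldsymbol\alpha_L\in\mathbb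 Z^d$, then for $j=mLd+(l-1)d+j'$ with $m\in\{0,1\}$, $1\le l\le L$, $1\le j'\le d$, set $\tilde g_{j,\boldsymbol\gamma}(t)=(-1)^m\omega_l\,g_{j',\boldsymbol\alpha_1,\ldots,\boldsymbol\alpha_L}(t)$; for all other $\boldsymbol\gamma$ set $\tilde{\mathbf g}_{\boldsymbol\gamma}(t)=\mathbf 0$. Then $\dot{\tilde{\mathbf x}}=\sum_{\boldsymbol\gamma\in\mathbb Z_+^{2dL}}\tilde{\mathbf g}_{\boldsymbol\gamma}(t)e^{i\boldsymbol\gamma\tilde{\mathbf x}}$, $\tilde{\mathbf x}(0)=\tilde{\mathbf x}_0$. Finite sections: for $1\le k\le l$ put $$\tilde{\mathbf B}_{k,l}(t)=\Big[\,i\sum_{j=1}^{2dL}\gamma_j\,\tilde g_{j,\boldsymbol\delta-\boldsymbol\gamma}(t)\Big]_{\boldsymbol\gamma\in\mathbb Z_{+,k}^{2dL},\ \boldsymbol\delta\in\mathbb Z_{+,l}^{2dL}} .$$ The finite-section approximation of order $N$ is the linear ODE system $$\dot{\tilde{\mathbf v}}_{k,N}(t)=\sum_{l=k}^N\tilde{\mathbf B}_{k,l}(t)\tilde{\mathbf v}_{l,N}(t),\qquad\tilde{\mathbf v}_{k,N}(0)=[e^{i\boldsymbol\gamma\tilde{\mathbf x}_0}]_{\boldsymbol\gamma\in\mathbb Z_{+,k}^{2dL}},\qquad1\le k\le N .$$ The first block $\tilde{\mathbf v}_{1,N}$ is indexed by the unit vectors $\mathbf e_1,\ldots,\mathbf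 e_{2dL}$; its entry with index $\mathbf e_j$ is the scalar denoted $\tilde v_{j,N}(t)$. *)

theory Defs
  imports "HOL-Analysis.Analysis"
begin

text \<open>
  The finite types \<open>'d\<close> and \<open>'l\<close> play the role of the index sets
  \<open>{1..d}\<close> and \<open>{1..L}\<close>. The position \<open>j = m L d + (l - 1) d + j'\<close> in the extended
  system of dimension \<open>2 d L\<close> is represented by the triple \<open>(m, l, j')\<close>, with \<open>m = 1\<close>
  represented by \<open>True\<close>. A family \<open>(\<alpha>\<^sub>1, \<dots>, \<alpha>\<^sub>L)\<close> of multi-indices is a
  vector \<open>\<alpha> :: int ^ 'd ^ 'l\<close> with \<open>\<alpha>\<^sub>l = \<alpha> $ l\<close>.
\<close>

type_synonym ('d, 'l) ext = "bool \<times> 'l \<times> 'd"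

text \<open>The pairing \<open>\<gamma> y = \<Sum>\<^sub>j \<gamma>\<^sub>j y\<^sub>j\<close> (bilinear, no complex conjugation).\<close>

definition mdot :: "int ^ 'i \<Rightarrow> complex ^ 'i \<Rightarrow> complex" where
  "mdot \<gamma> y = (\<Sum>j\<in>UNIV. of_int (\<gamma> $ j) * y $ j)"

definition msize :: "int ^ 'i \<Rightarrow> int" where
  "msize \<gamma> = (\<Sum>j\<in>UNIV. \<bar>\<gamma> $ j\<bar>)"

definition Zplus :: "nat \<Rightarrow> (int ^ 'i) set" where
  "Zplus k = {\<gamma>. (\<forall>j. 0 \<le> \<gamma> $ j) \<and> msize \<gamma> = int k}"

definition fourier_term ::
  "complex ^ 'l \<Rightarrow> (int ^ 'd ^ 'l \<Rightarrow> real \<Rightarrow> complex ^ 'd) \<Rightarrow>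
   real \<Rightarrow> complex ^ 'd \<Rightarrow> int ^ 'd ^ 'l \<Rightarrow> complex ^ 'd" where
  "fourier_term \<omega> a t x \<alpha> = exp (\<i> * (\<Sum>l\<in>UNIV. \<omega> $ l * mdot (\<alpha> $ l) x)) *s a \<alpha> t"

text \<open>
  \<open>g\<close> is the sum of the multi-frequency Fourier series with coefficients \<open>a\<close>. Under the
  decay condition \<open>O(R\<^sup>-\<^sup>k)\<close> on the coefficients the series need not converge on
  all of \<open>\<complex>\<^sup>d\<close>, so the identity is required exactly at those points where
  the series converges (unconditionally, that is, absolutely).
\<close>

definition has_fourier_form ::
  "complex ^ 'l \<Rightarrow> (int ^ 'd ^ 'l \<Rightarrow> real \<Rightarrow> complex ^ 'd) \<Rightarrow>
   (real \<Rightarrow> complex ^ 'd \<Rightarrow> complex ^ 'd) \<Rightarrow> bool" where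
  "has_fourier_form \<omega> a g \<longleftrightarrow>
     (\<forall>t\<ge>0. \<forall>x. fourier_term \<omega> a t x summable_on UNIV \<longrightarrow>
        (fourier_term \<omega> a t x has_sum g t x) UNIV)"

definition coeff_decay ::
  "complex ^ 'l \<Rightarrow> (int ^ 'd ^ 'l \<Rightarrow> real \<Rightarrow> complex ^ 'd) \<Rightarrow> real \<Rightarrow> real \<Rightarrow> bool" where
  "coeff_decay \<omega> a D R \<longleftrightarrow>
     (\<forall>k::nat. \<forall>t\<ge>0.
        (\<Sum>j\<in>UNIV. \<Sum>\<alpha> | (\<Sum>l\<in>UNIV. msize (\<alpha> $ l)) = int k. cmod (a \<alpha> t $ j))
          \<le> D / (2 * (\<Sum>l\<in>UNIV. cmod (\<omega> $ l)) * R ^ k))"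

definition solves_on ::
  "(real \<Rightarrow> complex ^ 'd \<Rightarrow> complex ^ 'd) \<Rightarrow> complex ^ 'd \<Rightarrow> real \<Rightarrow>
   (real \<Rightarrow> complex ^ 'd) \<Rightarrow> bool" where
  "solves_on g x0 T x \<longleftrightarrow> x 0 = x0 \<and>
     (\<forall>t\<in>{0..T}. (x has_vector_derivative g t (x t)) (at t within {0..T}))"

definition ext_sign :: "bool \<Rightarrow> complex" where
  "ext_sign m = (- 1) ^ (of_bool m :: nat)"

definition ext_state :: "complex ^ 'l \<Rightarrow> complex ^ 'd \<Rightarrow> complex ^ ('d, 'l) ext" where
  "ext_state \<omega> x = (\<chi> p. case p of (m, l, j) \<Rightarrow> ext_sign m * \<omega> $ l * x $ j)"

text \<open>
  The multi-index whose blocks are \<open>(\<alpha>\<^sub>1)\<^sub>+, \<dots>, (\<alpha>\<^sub>L)\<^sub>+\<close>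
  followed by \<open>(\<alpha>\<^sub>1)\<^sub>-, \<dots>, (\<alpha>\<^sub>L)\<^sub>-\<close>. It determines
  \<open>\<alpha>\<close>, which justifies the definite description in \<open>ext_coeff\<close>.
\<close>

definition ext_index :: "int ^ 'd ^ 'l \<Rightarrow> int ^ ('d, 'l) ext" where
  "ext_index \<alpha> =
     (\<chi> p. case p of (m, l, j) \<Rightarrow>
        if m then max (\<alpha> $ l $ j) 0 - \<alpha> $ l $ j else max (\<alpha> $ l $ j) 0)"

lemma inj_ext_index: "inj ext_index"
proof (rule injI)
  fix \<alpha> \<beta> :: "int ^ 'd ^ 'l"
  assume eq: "ext_index \<alpha> = ext_index \<beta>"
  have "\<alpha> $ l $ j = \<beta> $ l $ j" for l j
  proof -
    have "ext_index \<alpha> $ (True, l, j) = ext_index \<beta> $ (True, l, j)"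
      and "ext_index \<alpha> $ (False, l, j) = ext_index \<beta> $ (False, l, j)"
      using eq by simp_all
    then show ?thesis by (simp add: ext_index_def)
  qed
  then show "\<alpha> = \<beta>" by (simp add: vec_eq_iff)
qed

definition ext_coeff ::
  "complex ^ 'l \<Rightarrow> (int ^ 'd ^ 'l \<Rightarrow> real \<Rightarrow> complex ^ 'd) \<Rightarrow>
   int ^ ('d, 'l) ext \<Rightarrow> real \<Rightarrow> complex ^ ('d, 'l) ext" where
  "ext_coeff \<omega> a \<gamma> t =
     (if \<exists>\<alpha>. \<gamma> = ext_index \<alpha>
      then (\<chi> p. case p of (m, l, j) \<Rightarrow> ext_sign m * \<omega> $ l * a (THE \<alpha>. \<gamma> = ext_index \<alpha>) t $ j)
      else 0)"

text \<open>The \<open>(\<gamma>, \<delta>)\<close> entry of the block \<open>B\<^sub>k\<^sub>,\<^sub>l(t)\<close>, for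
  \<open>\<gamma> \<in> Zplus k\<close> and \<open>\<delta> \<in> Zplus l\<close>.\<close>

definition cf_entry ::
  "complex ^ 'l \<Rightarrow> (int ^ 'd ^ 'l \<Rightarrow> real \<Rightarrow> complex ^ 'd) \<Rightarrow>
   real \<Rightarrow> int ^ ('d, 'l) ext \<Rightarrow> int ^ ('d, 'l) ext \<Rightarrow> complex" where
  "cf_entry \<omega> a t \<gamma> \<delta> =
     \<i> * (\<Sum>j\<in>UNIV. of_int (\<gamma> $ j) * ext_coeff \<omega> a (\<delta> - \<gamma>) t $ j)"

text \<open>
  \<open>v k t \<gamma>\<close> is the entry with index \<open>\<gamma> \<in> Zplus k\<close> of the \<open>k\<close>-th block of the
  finite-section approximation of order \<open>N\<close>, on the time interval \<open>{0..T}\<close>.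
\<close>

definition finite_section ::
  "complex ^ 'l \<Rightarrow> (int ^ 'd ^ 'l \<Rightarrow> real \<Rightarrow> complex ^ 'd) \<Rightarrow> complex ^ 'd \<Rightarrow>
   real \<Rightarrow> nat \<Rightarrow> (nat \<Rightarrow> real \<Rightarrow> int ^ ('d, 'l) ext \<Rightarrow> complex) \<Rightarrow> bool" where
  "finite_section \<omega> a x0 T N v \<longleftrightarrow>
     (\<forall>k\<in>{1..N}. \<forall>\<gamma>\<in>Zplus k.
        v k 0 \<gamma> = exp (\<i> * mdot \<gamma> (ext_state \<omega> x0)) \<and>
        (\<forall>t\<in>{0..T}.
           ((\<lambda>s. v k s \<gamma>) has_vector_derivative
              (\<Sum>l=k..N. \<Sum>\<delta>\<in>Zplus l. cf_entry \<omega> a t \<gamma> \<delta> * v l t \<delta>)) (at t within {0..T})))"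

definition max_Im :: "complex ^ 'l \<Rightarrow> complex ^ 'd \<Rightarrow> real" where
  "max_Im \<omega> x = (MAX l. MAX j. \<bar>Im (\<omega> $ l * x $ j)\<bar>)"

definition T_CF :: "complex ^ 'l \<Rightarrow> complex ^ 'd \<Rightarrow> real \<Rightarrow> real \<Rightarrow> real" where
  "T_CF \<omega> x0 D R = (exp 1 - 1) / (D * (2 * exp 1 - 1)) * (ln R - 1 - max_Im \<omega> x0)"

definition C_CF :: "complex ^ 'l \<Rightarrow> complex ^ 'd \<Rightarrow> real \<Rightarrow> real" where
  "C_CF \<omega> x0 R =
     1 / (sqrt (2 * pi) * (exp 1 - 1)) *
     exp ((3 * exp 1 - 1) / (2 * exp 1 - 1) * ln R
          + (exp 1 - 1) / (2 * exp 1 - 1) * max_Im \<omega> x0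
          - exp 1 / (2 * exp 1 - 1))"

text \<open>The index sets over which finite sums are taken above are indeed finite.\<close>

lemma msize_nth_le: "\<bar>\<gamma> $ j\<bar> \<le> msize \<gamma>"
  unfolding msize_def by (rule member_le_sum) auto

lemma finite_int_vec:
  assumes "finite A"
  shows "finite {\<gamma> :: 'a ^ 'i. \<forall>j. \<gamma> $ j \<in> A}"
proof -
  have "vec_nth ` {\<gamma> :: 'a ^ 'i. \<forall>j. \<gamma> $ j \<in> A} \<subseteq> {f. range f \<subseteq> A}"
    by auto
  moreover have "finite {f :: 'i \<Rightarrow> 'a. range f \<subseteq> A}"
    using finite_set_of_finite_funs[OF finite_class.finite_UNIV assms, of undefined]
    by (simp add: image_subset_iff)
  ultimately have "finite (vec_nth ` {\<gamma> :: 'a ^ 'i. \<forall>j. \<gamma> $ j \<in> A})"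
    by (rule finite_subset)
  then show ?thesis
    by (rule finite_imageD) (simp add: inj_on_def vec_nth_inject)
qed

lemma finite_Zplus: "finite (Zplus k :: (int ^ 'i) set)"
proof (rule finite_subset)
  show "Zplus k \<subseteq> {\<gamma> :: int ^ 'i. \<forall>j. \<gamma> $ j \<in> {- int k..int k}}"
  proof
    fix \<gamma> :: "int ^ 'i" assume "\<gamma> \<in> Zplus k"
    then have "\<bar>\<gamma> $ j\<bar> \<le> int k" for j
      using msize_nth_le[of \<gamma> j] by (simp add: Zplus_def)
    then show "\<gamma> \<in> {\<gamma>. \<forall>j. \<gamma> $ j \<in> {- int k..int k}}" by (auto simp: abs_le_iff minus_le_iff)
  qed
qed (rule finite_int_vec, simp)

lemma finite_coeff_level:
  "finite {\<alpha> :: int ^ 'd ^ 'l. (\<Sum>l\<in>UNIV. msize (\<alpha> $ l)) = int k}"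
proof (rule finite_subset)
  let ?B = "{\<beta> :: int ^ 'd. \<forall>j. \<beta> $ j \<in> {- int k..int k}}"
  show "{\<alpha> :: int ^ 'd ^ 'l. (\<Sum>l\<in>UNIV. msize (\<alpha> $ l)) = int k} \<subseteq> {\<alpha>. \<forall>l. \<alpha> $ l \<in> ?B}"
  proof
    fix \<alpha> :: "int ^ 'd ^ 'l"
    assume *: "\<alpha> \<in> {\<alpha>. (\<Sum>l\<in>UNIV. msize (\<alpha> $ l)) = int k}"
    have "\<bar>\<alpha> $ l $ j\<bar> \<le> int k" for l j
    proof -
      have "msize (\<alpha> $ l) \<le> (\<Sum>l\<in>UNIV. msize (\<alpha> $ l))"
        by (rule member_le_sum) (auto simp: msize_def intro: sum_nonneg)
      then show ?thesis using * msize_nth_le[of "\<alpha> $ l" j] by simp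
    qed
    then show "\<alpha> \<in> {\<alpha>. \<forall>l. \<alpha> $ l \<in> ?B}" by (auto simp: abs_le_iff minus_le_iff)
  qed
  show "finite {\<alpha> :: int ^ 'd ^ 'l. \<forall>l. \<alpha> $ l \<in> ?B}"
    by (intro finite_int_vec) simp
qed

end

theory Submission
  imports Defs
begin

text \<open>
  Along the solution the modes \<open>w\<^sub>\<gamma> = e\<^sup>i\<^sup>\<gamma>\<^sup>x\<close> of the extended state \<open>x\<close> satisfy an infinite
  upper triangular linear system, whose blocks of size up to \<open>N\<close> form the finite section.
  The coupling to the discarded modes feeds errors into all blocks, which the system then amplifies.

  Convergence of the expansion is guaranteed only while the imaginary parts of the extended state stay below \<open>ln R\<close>. They
  start below \<open>ln R - 1\<close>, and while they remain there they grow at most at the rate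
  \<open>D\<^sub>1 e / (e - 1)\<close>, so a continuity argument keeps them below \<open>ln R - 1\<close> up to the time
  in the theorem (\<open>imaginary_part_growth\<close>).

  The \<open>(k, l)\<close> block has row sums at most \<open>k D\<^sub>1 R\<^sup>k\<^sup>-\<^sup>l\<close>. Hence the errors
  \<open>u\<^sub>k\<close> of the blocks, divided by \<open>R\<^sup>k\<close>, grow at most like the solutions of
  \<open>u\<^sub>k' = k D\<^sub>1 (\<Sum>\<^sub>k\<^sub>\<le>\<^sub>l\<^sub>\<le>\<^sub>N u\<^sub>l + F)\<close>,
  where \<open>F\<close> bounds the sum of the equally scaled discarded modes (\<open>section_error_rate\<close>). The
  matrix with entries \<open>k\<close> for \<open>k \<le> l\<close> has the largest eigenvalue \<open>N\<close>, and its eigenvector is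
  explicit and positive. The corresponding exponential solution, corrected by \<open>F\<close> in the
  last component, dominates all errors (\<open>finite_section_error\<close>). Its first component contains
  \<open>N\<^sup>N\<^sup>-\<^sup>1 / N!\<close>, which Stirling's lower bound turns into
  \<open>e\<^sup>N N\<^sup>-\<^sup>3\<^sup>/\<^sup>2 / \<surd>(2 \<pi>)\<close> (\<open>critical_eigenvector_one\<close>).

  If \<open>M(t)\<close> is the bound for the imaginary parts, then \<open>F\<close> is of order \<open>(e\<^sup>M / R)\<^sup>N\<^sup>+\<^sup>1\<close>.
  Altogether the error is of order \<open>e\<^sup>N\<^sup>h\<close> for \<open>h = 1 + D\<^sub>1 t + M(t) - ln R\<close>, which is an affine
  function of \<open>t\<close> with slope at least \<open>D\<^sub>1\<close> and with its zero at the time in the theorem; before that,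
  decay at the rate of the theorem follows.
\<close>

section \<open>Stirling's lower bound\<close>

text \<open>
  The logarithm of \<open>n! / (\<surd>n (n/e)\<^sup>n)\<close>. It decreases to \<open>ln (2 \<pi>) / 2\<close>, which is what makes the
  constant \<open>\<surd>(2 \<pi>)\<close> in Stirling's formula a lower bound for every \<open>n\<close>.
\<close>

definition stirling_defect :: "nat \<Rightarrow> real" where
  "stirling_defect n = ln (fact n) + real n - (real n + 1 / 2) * ln (real n)"

text \<open>
  The difference is \<open>(n + 1/2) ln (1 + 1/n) - 1\<close>. The midpoint rule bounds the integral of
  \<open>1/x\<close> over \<open>[n, n + 1]\<close> from below and makes it nonnegative; the trapezoidal rule bounds it from
  above by a telescoping term, so that the defects cannot tend to \<open>-\<infinity>\<close>.
\<close>

lemma stirling_defect_diff: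
  assumes "n \<ge> 1"
  shows "stirling_defect n - stirling_defect (Suc n) \<in> {0..1 / (4 * real n) - 1 / (4 * real (Suc n))}"
proof -
  have n: "real n > 0" using assms by simp
  let ?d = "ln (real n + 1) - ln (real n)"
  have diff: "stirling_defect n - stirling_defect (Suc n) = (real n + 1 / 2) * ?d - 1"
  proof -
    have f: "ln (fact (Suc n)) = ln (real n + 1) + ln (fact n :: real)"
      using n by (simp add: ln_mult add.commute)
    show ?thesis unfolding stirling_defect_def f by (simp add: algebra_simps)
  qed
  have "2 / (2 * real n + 1) \<le> ?d"
    using ln_inverse_approx_ge[of "real n" "real n + 1"] n by (simp add: algebra_simps)
  then have "(real n + 1 / 2) * (2 / (2 * real n + 1)) \<le> (real n + 1 / 2) * ?d"
    using n by (intro mult_left_mono) auto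
  moreover have "(real n + 1 / 2) * (2 / (2 * real n + 1)) = 1"
    using n by (simp add: field_simps)
  moreover have "?d \<le> (inverse (real n) + inverse (real n + 1)) / 2"
    using ln_inverse_approx_le[of "real n" 1] n by simp
  then have "(real n + 1 / 2) * ?d \<le> (real n + 1 / 2) * ((inverse (real n) + inverse (real n + 1)) / 2)"
    using n by (intro mult_left_mono) auto
  moreover have "(real n + 1 / 2) * ((inverse (real n) + inverse (real n + 1)) / 2)
      = 1 + (1 / (4 * real n) - 1 / (4 * real (Suc n)))"
    using n by (simp add: divide_simps) (simp add: algebra_simps)
  ultimately show ?thesis unfolding diff atLeastAtMost_iff by linarith
qed

lemma wallis_product_fact:
  "(\<Prod>k=1..n. (4 * real k ^ 2) / (4 * real k ^ 2 - 1))
     = (2 ^ n * fact n) ^ 4 / ((fact (2 * n)) ^ 2 * (2 * real n + 1))"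
proof (induction n)
  case (Suc n)
  let ?p = "\<Prod>k=1..n. (4 * real k ^ 2) / (4 * real k ^ 2 - 1)"
  define r where "r = real n"
  have r: "r \<ge> 0" by (simp add: r_def)
  have e1: "4 * (r + 1) ^ 2 - 1 = (2 * r + 1) * (2 * r + 3)"
    by (simp add: r_def power2_eq_square algebra_simps)
  have e2: "fact (2 * Suc n) = (2 * r + 1) * (2 * (r + 1)) * (fact (2 * n) :: real)"
    by (simp add: r_def algebra_simps)
  have e3: "fact (Suc n) = (r + 1) * (fact n :: real)" by (simp add: r_def algebra_simps)
  have e4: "2 * real (Suc n) + 1 = 2 * r + 3" "real (Suc n) = r + 1" by (simp_all add: r_def)
  have "(\<Prod>k=1..Suc n. (4 * real k ^ 2) / (4 * real k ^ 2 - 1))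
      = ?p * ((4 * (r + 1) ^ 2) / ((2 * r + 1) * (2 * r + 3)))"
    by (subst prod.nat_ivl_Suc') (simp, simp only: e4 e1 mult.commute)
  also have "\<dots> = (2 ^ n * fact n) ^ 4 / ((fact (2 * n)) ^ 2 * (2 * r + 1))
       * ((4 * (r + 1) ^ 2) / ((2 * r + 1) * (2 * r + 3)))"
    by (simp only: Suc.IH r_def)
  also have "\<dots> = (2 ^ Suc n * fact (Suc n)) ^ 4 / ((fact (2 * Suc n)) ^ 2 * (2 * real (Suc n) + 1))"
  proof -
    have nz: "(fact (2 * n) :: real) \<noteq> 0" "2 * r + 1 \<noteq> 0" "2 * r + 3 \<noteq> 0" "r + 1 \<noteq> 0"
      using r by auto
    show ?thesis
      unfolding e2 e3 e4(1) power_Suc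
      using nz by (simp add: divide_simps) (simp add: power_mult_distrib eval_nat_numeral algebra_simps)
  qed
  finally show ?case .
qed simp

text \<open>
  Monotonicity and the telescoping lower bound give a limit \<open>\<beta>\<close>. Wallis' product involves the
  factorials of \<open>n\<close> and \<open>2 n\<close>; in its logarithm all growing terms cancel and
  \<open>2 \<beta> - ln 4 = ln (\<pi> / 2)\<close> remains.
\<close>

lemma stirling_defect_limit: "stirling_defect \<longlonglongrightarrow> ln (2 * pi) / 2"
proof -
  let ?b = "\<lambda>n. stirling_defect (Suc n)"
  have step: "?b n - ?b (Suc n) \<in> {0..1 / (4 * real (Suc n)) - 1 / (4 * real (Suc (Suc n)))}" for n
    by (rule stirling_defect_diff) simp
  have dec: "decseq ?b"
    using step by (intro decseq_SucI) (auto simp: algebra_simps)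
  have low: "?b 0 - 1 / 4 + 1 / (4 * real (Suc n)) \<le> ?b n" for n
  proof (induction n)
    case (Suc n)
    then show ?case using step[of n] by simp
  qed simp
  have "?b 0 - 1 / 4 \<le> ?b n" for n
    using low[of n] by (rule order_trans[rotated]) simp
  then obtain \<beta> where "?b \<longlonglongrightarrow> \<beta>"
    using decseq_convergent[OF dec] by metis
  then have lim: "stirling_defect \<longlonglongrightarrow> \<beta>" by (simp only: filterlim_sequentially_Suc)
  have lim2: "(\<lambda>n. stirling_defect (2 * n)) \<longlonglongrightarrow> \<beta>"
    using LIMSEQ_subseq_LIMSEQ[OF lim, of "\<lambda>n. 2 * n"] by (simp add: strict_mono_def o_def)
  let ?P = "\<lambda>n. \<Prod>k=1..n. (4 * real k ^ 2) / (4 * real k ^ 2 - 1)"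
  have lnP: "ln (?P n) = 4 * stirling_defect n - 2 * stirling_defect (2 * n) - ln (4 + 2 / real n)"
    if "n \<ge> 1" for n
  proof -
    have n: "real n > 0" using that by simp
    have "ln (?P n) = 4 * (n * ln 2 + ln (fact n)) - (2 * ln (fact (2 * n)) + ln (2 * real n + 1))"
      unfolding wallis_product_fact using n
      by (simp add: ln_div ln_mult ln_realpow)
    moreover have "ln (4 + 2 / real n) = ln 2 + ln (2 * real n + 1) - ln (real n)"
    proof -
      have "4 + 2 / real n = 2 * (2 * real n + 1) / real n" using n by (simp add: field_simps)
      then have "ln (4 + 2 / real n) = ln (2 * (2 * real n + 1)) - ln (real n)"
        using n by (simp add: ln_div)
      then show ?thesis using n by (subst (asm) ln_mult) auto
    qed
    ultimately show ?thesis using n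
      by (simp add: stirling_defect_def ln_mult algebra_simps)
  qed
  have "(\<lambda>n. 4 * stirling_defect n - 2 * stirling_defect (2 * n) - ln (4 + 2 / real n))
      \<longlonglongrightarrow> 4 * \<beta> - 2 * \<beta> - ln (4 + 0)"
    by (intro tendsto_intros lim lim2 lim_const_over_n) auto
  moreover have "(\<lambda>n. ln (?P n)) \<longlonglongrightarrow> ln (pi / 2)"
    by (intro tendsto_ln wallis) simp
  then have "(\<lambda>n. 4 * stirling_defect n - 2 * stirling_defect (2 * n) - ln (4 + 2 / real n))
      \<longlonglongrightarrow> ln (pi / 2)"
    by (rule Lim_transform_eventually) (use lnP in \<open>auto intro!: eventually_sequentiallyI[of 1]\<close>)
  ultimately have "4 * \<beta> - 2 * \<beta> - ln (4 + 0) = ln (pi / 2)" by (rule LIMSEQ_unique)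
  then have "\<beta> = (ln (pi / 2) + ln 4) / 2" by simp
  also have "\<dots> = ln (2 * pi) / 2" using ln_mult_pos[of "pi / 2" 4] by (simp add: mult.commute)
  finally have "\<beta> = ln (2 * pi) / 2" .
  with lim show ?thesis by (simp only:)
qed

lemma stirling_lower_bound:
  assumes "n \<ge> 1"
  shows "sqrt (2 * pi * n) * (real n / exp 1) ^ n \<le> fact n"
proof -
  have n: "real n > 0" using assms by simp
  obtain m where m: "n = Suc m" using assms by (cases n) auto
  have dec: "decseq (\<lambda>n. stirling_defect (Suc n))"
    using stirling_defect_diff[of "Suc _"] by (intro decseq_SucI) (auto simp: algebra_simps)
  have "(\<lambda>n. stirling_defect (Suc n)) \<longlonglongrightarrow> ln (2 * pi) / 2"
    using stirling_defect_limit by (simp only: filterlim_sequentially_Suc)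
  then have "ln (2 * pi) / 2 \<le> stirling_defect n"
    unfolding m by (rule decseq_ge[OF dec])
  then have "ln (2 * pi) / 2 + (real n + 1 / 2) * ln n - n \<le> ln (fact n)"
    by (simp add: stirling_defect_def)
  moreover have "ln (sqrt (2 * pi * n) * (real n / exp 1) ^ n) = ln (2 * pi) / 2 + (real n + 1 / 2) * ln n - n"
    using n by (simp add: ln_mult ln_div ln_realpow ln_sqrt algebra_simps add_divide_distrib)
  ultimately have "ln (sqrt (2 * pi * n) * (real n / exp 1) ^ n) \<le> ln (fact n)" by simp
  moreover have "0 < sqrt (2 * pi * n) * (real n / exp 1) ^ n" using n by simp
  ultimately show ?thesis by (simp only: ln_le_cancel_iff fact_gt_zero)
qed

section \<open>A comparison principle\<close>

text \<open>
  At the first time at which one of the finitely many functions reaches its barrier, all the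
  derivative bounds have been valid so far, so the mean value inequality shows that this function has
  grown by no more than its barrier; having started strictly below, it cannot have reached it.
  Bounding increments rather than integrating right-hand sides suits a linear system whose
  coefficients are arbitrary functions of \<open>t\<close>. The conclusion is about increments too, so that the
  strict gap at time \<open>0\<close> does not enter the estimates derived from it.
\<close>

lemma first_touch_bound:
  fixes f f' :: "'i \<Rightarrow> real \<Rightarrow> 'a::real_normed_vector" and U U' :: "'i \<Rightarrow> real \<Rightarrow> real"
  assumes "finite I"
    and df: "\<And>i t. i \<in> I \<Longrightarrow> t \<in> {0..T} \<Longrightarrow> (f i has_vector_derivative f' i t) (at t within {0..T})"
    and dU: "\<And>i t. i \<in> I \<Longrightarrow> t \<in> {0..T} \<Longrightarrow> (U i has_vector_derivative U' i t) (at t within {0..T})"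
    and start: "\<And>i. i \<in> I \<Longrightarrow> norm (f i 0) < U i 0"
    and step: "\<And>i t. i \<in> I \<Longrightarrow> t \<in> {0..T} \<Longrightarrow> (\<And>j. j \<in> I \<Longrightarrow> norm (f j t) \<le> U j t)
                 \<Longrightarrow> norm (f' i t) \<le> U' i t"
    and "i \<in> I" "t \<in> {0..T}"
  shows "norm (f i t - f i 0) \<le> U i t - U i 0"
proof -
  have increment: "norm (f i s - f i 0) \<le> U i s - U i 0"
    if i: "i \<in> I" and s: "s \<in> {0..T}"
      and below: "\<And>r j. 0 \<le> r \<Longrightarrow> r < s \<Longrightarrow> j \<in> I \<Longrightarrow> norm (f j r) \<le> U j r" for i s
  proof (cases "s = 0")
    case False
    have within: "(h has_vector_derivative h') (at r)"
      if "(h has_vector_derivative h') (at r within {0..T})" "0 < r" "r < s"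
      for h :: "real \<Rightarrow> 'b::real_normed_vector" and h' r
    proof -
      have "(h has_vector_derivative h') (at r within {0<..<T})"
        by (rule has_vector_derivative_within_subset[OF that(1)]) auto
      then show ?thesis
        using that s by (simp add: at_within_open[of r "{0<..<T}"])
    qed
    have sub: "{0..s} \<subseteq> {0..T}" using s by auto
    show ?thesis
    proof (rule differentiable_bound_general)
      show "0 < s" using False s by auto
      show "continuous_on {0..s} (f i)"
        using df[OF i] by (intro continuous_on_subset[OF _ sub])
          (metis continuous_on_eq_continuous_within has_vector_derivative_continuous)
      show "continuous_on {0..s} (U i)"
        using dU[OF i] by (intro continuous_on_subset[OF _ sub])
          (metis continuous_on_eq_continuous_within has_vector_derivative_continuous)
      fix r assume r: "0 < r" "r < s"
      then have rT: "r \<in> {0..T}" using s by auto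
      show "(f i has_vector_derivative f' i r) (at r)" by (rule within[OF df[OF i rT] r])
      show "(U i has_vector_derivative U' i r) (at r)" by (rule within[OF dU[OF i rT] r])
      show "norm (f' i r) \<le> U' i r" using below r by (intro step i rT) auto
    qed
  qed simp
  \<comment> \<open>The times at which some barrier is reached; its infimum is the first touch.\<close>
  define B where "B = (\<Union>j\<in>I. {s \<in> {0..T}. U j s \<le> norm (f j s)})"
  have "B = {}"
  proof (rule ccontr)
    assume ne: "B \<noteq> {}"
    have cont: "continuous_on {0..T} (f j)" "continuous_on {0..T} (U j)" if "j \<in> I" for j
      using df[OF that] dU[OF that]
      by (metis continuous_on_eq_continuous_within has_vector_derivative_continuous)+
    have "closed B"
      unfolding B_def using cont \<open>finite I\<close>
      by (intro closed_UN ballI continuous_on_closed_Collect_le continuous_on_norm) auto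
    moreover have bdd: "bdd_below B" by (rule bdd_belowI[of _ 0]) (auto simp: B_def)
    ultimately have inB: "Inf B \<in> B" using ne by (intro closed_contains_Inf)
    then obtain j where j: "j \<in> I" "Inf B \<in> {0..T}" "U j (Inf B) \<le> norm (f j (Inf B))"
      by (auto simp: B_def)
    have "norm (f k r) \<le> U k r" if "0 \<le> r" "r < Inf B" "k \<in> I" for k r
    proof (rule ccontr)
      assume "\<not> ?thesis"
      then have "r \<in> B" using that j(2) by (auto simp: B_def intro!: bexI[of _ k])
      then show False using cInf_lower[OF _ bdd] that(2) by fastforce
    qed
    then have "norm (f j (Inf B) - f j 0) \<le> U j (Inf B) - U j 0"
      by (intro increment j) auto
    then show False
      using start[OF j(1)] j(3) norm_triangle_ineq2[of "f j (Inf B)" "f j 0"] by linarith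
  qed
  have "norm (f j r) \<le> U j r" if "j \<in> I" "0 \<le> r" "r < t" for j r
  proof (rule ccontr)
    assume "\<not> norm (f j r) \<le> U j r"
    then have "r \<in> B" using that \<open>t \<in> {0..T}\<close> by (auto simp: B_def intro!: bexI[of _ j])
    then show False using \<open>B = {}\<close> by simp
  qed
  then show ?thesis by (intro increment assms) auto
qed

section \<open>The dominant eigenvector of the comparison system\<close>

text \<open>
  The eigenvector for the largest eigenvalue \<open>N\<close> of the upper triangular matrix whose
  \<open>(k, l)\<close> entry is \<open>k\<close> for \<open>1 \<le> k \<le> l \<le> N\<close>, normalised to \<open>1\<close> at
  \<open>k = N\<close>. Its tail sums \<open>S\<^sub>k\<close> satisfy \<open>(N - k) S\<^sub>k = N S\<^sub>k\<^sub>+\<^sub>1\<close>,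
  so \<open>S\<^sub>k = N\<^sup>N\<^sup>-\<^sup>k / (N - k)!\<close>.
\<close>

definition critical_eigenvector :: "nat \<Rightarrow> nat \<Rightarrow> real" where
  "critical_eigenvector N k = real k * real N ^ (N - k) / (real N * fact (N - k))"

lemma sum_critical_eigenvector:
  assumes "k \<le> N" "N \<ge> 1"
  shows "real k * (\<Sum>l=k..N. critical_eigenvector N l) = real N * critical_eigenvector N k"
proof -
  have "(\<Sum>l=k..N. critical_eigenvector N l) = real N ^ (N - k) / fact (N - k)"
    using assms(1)
  proof (induction rule: inc_induct)
    case base
    then show ?case using assms by (simp add: critical_eigenvector_def)
  next
    case (step k)
    define m where "m = N - Suc k"
    have m: "N - k = Suc m" "real k = real N - real m - 1" "real N > 0"
      using step(2) by (auto simp: m_def of_nat_diff)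
    have "(\<Sum>l=k..N. critical_eigenvector N l) = critical_eigenvector N k + (\<Sum>l=Suc k..N. critical_eigenvector N l)"
      using step(2) by (intro sum.atLeast_Suc_atMost) simp
    also have "\<dots> = real k * real N ^ Suc m / (real N * fact (Suc m)) + real N ^ m / fact m"
      unfolding step.IH by (simp only: critical_eigenvector_def m(1) m_def)
    also have "\<dots> = real N ^ Suc m / fact (Suc m)"
      unfolding m(2) using m(3) by (simp add: divide_simps) (simp add: algebra_simps)
    finally show ?case by (simp only: m)
  qed
  then show ?thesis using assms by (simp add: critical_eigenvector_def)
qed

text \<open>
  The first component is \<open>N\<^sup>N\<^sup>-\<^sup>1 / N!\<close>; this is the origin of the
  factor \<open>N\<^sup>-\<^sup>3\<^sup>/\<^sup>2 / \<surd>(2 \<pi>)\<close> in the convergence rate.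
\<close>

lemma critical_eigenvector_one:
  assumes "N \<ge> 1"
  shows "critical_eigenvector N 1 \<le> exp (real N) * real N powr (- 3 / 2) / sqrt (2 * pi)"
proof -
  have N: "real N > 0" using assms by simp
  have f: "fact N = real N * fact (N - 1)" using assms by (metis fact_reduce of_nat_fact of_nat_mult less_le_trans zero_less_one)
  have pw: "real N ^ N = real N * real N ^ (N - 1)" using assms by (metis power_eq_if not_one_le_zero)
  have p: "real N powr (- 3 / 2) = 1 / (real N * sqrt N)"
  proof -
    have "real N powr (- 3 / 2) = real N powr (- (1 + 1 / 2))" by simp
    also have "\<dots> = 1 / (real N * sqrt N)"
      using N by (simp only: powr_minus powr_add powr_half_sqrt) (simp add: inverse_eq_divide)
    finally show ?thesis .
  qed
  have "critical_eigenvector N 1 = real N ^ N / (real N * fact N)"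
    unfolding critical_eigenvector_def f pw using N by simp
  also have "\<dots> \<le> real N ^ N / (real N * (sqrt (2 * pi * N) * (real N / exp 1) ^ N))"
    using N stirling_lower_bound[OF assms]
    by (intro divide_left_mono mult_left_mono mult_pos_pos) auto
  also have "\<dots> = exp (real N) * real N powr (- 3 / 2) / sqrt (2 * pi)"
    unfolding p using N by (simp add: power_divide exp_of_nat_mult[symmetric] real_sqrt_mult field_simps)
  finally show ?thesis .
qed

section \<open>Families with geometrically decaying level sums\<close>

text \<open>
  Summation over all indices from level \<open>n\<close> on is compared with the tail of a geometric series. The
  case \<open>n = 0\<close> gives convergence of the Fourier series, the other cases bound what truncation discards.
\<close>

lemma level_sum_bound:
  fixes \<phi> :: "'a \<Rightarrow> real" and lev :: "'a \<Rightarrow> nat"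
  assumes nonneg: "\<And>\<alpha>. \<phi> \<alpha> \<ge> 0"
    and fin: "\<And>k. finite {\<alpha>. lev \<alpha> = k}"
    and level: "\<And>k. (\<Sum>\<alpha> | lev \<alpha> = k. \<phi> \<alpha>) \<le> C * q ^ k"
    and q: "0 \<le> q" "q < 1"
  shows "\<phi> summable_on {\<alpha>. n \<le> lev \<alpha>}"
    and "infsum \<phi> {\<alpha>. n \<le> lev \<alpha>} \<le> C * q ^ n / (1 - q)"
proof -
  let ?A = "{\<alpha>. n \<le> lev \<alpha>}"
  have "0 \<le> (\<Sum>\<alpha> | lev \<alpha> = 0. \<phi> \<alpha>)" by (intro sum_nonneg nonneg)
  then have C: "C \<ge> 0" using level[of 0] by simp
  have bound: "sum \<phi> F \<le> C * q ^ n / (1 - q)" if F: "finite F" "F \<subseteq> ?A" for F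
  proof -
    define m where "m = Suc (Max (insert n (lev ` F)))"
    have m: "lev \<alpha> < m" if "\<alpha> \<in> F" for \<alpha>
      using that F(1) by (auto simp: m_def less_Suc_eq_le intro!: Max_ge)
    have nm: "n < m" using F(1) by (auto simp: m_def less_Suc_eq_le intro!: Max_ge)
    have "sum \<phi> F \<le> sum \<phi> (\<Union>k\<in>{n..<m}. {\<alpha>. lev \<alpha> = k})"
      using F m fin nonneg by (intro sum_mono2) auto
    also have "\<dots> = (\<Sum>k=n..<m. \<Sum>\<alpha> | lev \<alpha> = k. \<phi> \<alpha>)"
      using fin by (intro sum.UNION_disjoint) auto
    also have "\<dots> \<le> (\<Sum>k=n..<m. C * q ^ k)" by (intro sum_mono level)
    also have "\<dots> = C * (\<Sum>k=n..<m. q ^ k)" by (simp add: sum_distrib_left)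
    also have "(\<Sum>k=n..<m. q ^ k) = (q ^ n - q ^ m) / (1 - q)"
      using less_imp_le[OF nm]
    proof (induction m rule: dec_induct)
      case (step m)
      then have "(\<Sum>k=n..<Suc m. q ^ k) = (q ^ n - q ^ m) / (1 - q) + q ^ m" by simp
      then show ?case using q by (simp add: divide_simps) (simp add: algebra_simps)
    qed simp
    also have "C * ((q ^ n - q ^ m) / (1 - q)) \<le> C * (q ^ n / (1 - q))"
      using q C by (intro mult_left_mono divide_right_mono) auto
    finally show ?thesis by simp
  qed
  show s: "\<phi> summable_on ?A"
    by (rule nonneg_bdd_above_summable_on) (auto intro!: nonneg bdd_aboveI2 bound)
  show "infsum \<phi> ?A \<le> C * q ^ n / (1 - q)"
    by (rule infsum_le_finite_sums[OF s bound])
qed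

section \<open>The Fourier modes of the extended system\<close>

definition index_degree :: "int ^ 'd ^ 'l \<Rightarrow> nat" where
  "index_degree \<alpha> = nat (\<Sum>l\<in>UNIV. msize (\<alpha> $ l))"

lemma msize_nonneg: "0 \<le> msize \<gamma>"
  by (simp add: msize_def sum_nonneg)

lemma of_nat_index_degree: "int (index_degree \<alpha>) = (\<Sum>l\<in>UNIV. msize (\<alpha> $ l))"
  by (simp add: index_degree_def sum_nonneg msize_nonneg)

lemma index_degree_level: "{\<alpha>. index_degree \<alpha> = k} = {\<alpha>. (\<Sum>l\<in>UNIV. msize (\<alpha> $ l)) = int k}"
  by (simp flip: of_nat_index_degree)

lemma finite_index_degree: "finite {\<alpha> :: int ^ 'd ^ 'l. index_degree \<alpha> = k}"
  unfolding index_degree_level by (rule finite_coeff_level)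

text \<open>
  Pairs each coordinate of the extended state with the one of opposite sign; the two index blocks
  \<open>\<alpha>\<^sub>+\<close> and \<open>\<alpha>\<^sub>-\<close> recombine in this form to \<open>\<alpha>\<close> or to its size.
\<close>

lemma sum_ext_UNIV:
  fixes f :: "('d::finite, 'l::finite) ext \<Rightarrow> 'b::comm_monoid_add"
  shows "sum f UNIV = (\<Sum>l\<in>UNIV. \<Sum>j\<in>UNIV. f (False, l, j) + f (True, l, j))"
proof -
  have "sum f UNIV = (\<Sum>m\<in>UNIV. \<Sum>l\<in>UNIV. \<Sum>j\<in>UNIV. f (m, l, j))"
    by (simp only: sum.cartesian_product UNIV_Times_UNIV[symmetric] case_prod_unfold prod.collapse)
  then show ?thesis by (simp add: UNIV_bool sum.distrib)
qed

lemma ext_coeff_ext_index: "ext_coeff \<omega> a (ext_index \<alpha>) t = ext_state \<omega> (a \<alpha> t)"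
proof -
  have "(THE \<beta>. ext_index \<alpha> = ext_index \<beta>) = \<alpha>"
    using inj_ext_index by (auto simp: inj_def)
  then show ?thesis by (auto simp: ext_coeff_def ext_state_def)
qed

lemma ext_index_nonneg: "0 \<le> ext_index \<alpha> $ p"
  by (cases p) (simp add: ext_index_def)

lemma msize_ext_index: "msize (ext_index \<alpha>) = int (index_degree \<alpha>)"
  unfolding of_nat_index_degree msize_def[of "ext_index \<alpha>"] sum_ext_UNIV
  by (auto simp: msize_def ext_index_def intro!: sum.cong)

lemma msize_add:
  assumes "\<And>p. 0 \<le> \<gamma> $ p" "\<And>p. 0 \<le> \<delta> $ p"
  shows "msize (\<gamma> + \<delta>) = msize \<gamma> + msize \<delta>"
  using assms by (simp add: msize_def sum.distrib)

lemma add_ext_index_Zplus: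
  assumes "\<gamma> \<in> Zplus k"
  shows "\<gamma> + ext_index \<alpha> \<in> Zplus (k + index_degree \<alpha>)"
proof -
  have nonneg: "0 \<le> \<gamma> $ p" for p using assms unfolding Zplus_def by blast
  then show ?thesis
    using assms msize_add[OF nonneg ext_index_nonneg]
    by (simp add: Zplus_def ext_index_nonneg msize_ext_index)
qed

lemma linear_ext_state: "linear (ext_state \<omega>)"
  by (rule linearI) (auto simp: ext_state_def vec_eq_iff algebra_simps)

lemma linear_Im_ext_state: "linear (\<lambda>y. Im (ext_state \<omega> y $ p))"
  by (intro linearI) (simp_all add: linear_add[OF linear_ext_state] linear_scale[OF linear_ext_state])

lemma linear_mdot: "linear (mdot \<gamma>)"
  by (rule linearI) (auto simp: mdot_def sum.distrib scaleR_sum_right distrib_left)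

text \<open>
  The exponentials \<open>e\<^sup>i\<^sup>\<gamma>\<^sup>x\<close> evaluated at the extended state, which are the exact
  unknowns that the finite sections approximate.
\<close>

definition ext_mode :: "complex ^ 'l \<Rightarrow> complex ^ 'd \<Rightarrow> int ^ ('d, 'l) ext \<Rightarrow> complex" where
  "ext_mode \<omega> y \<gamma> = exp (\<i> * mdot \<gamma> (ext_state \<omega> y))"

lemma ext_mode_add: "ext_mode \<omega> y (\<gamma> + \<delta>) = ext_mode \<omega> y \<gamma> * ext_mode \<omega> y \<delta>"
  by (simp add: ext_mode_def mdot_def algebra_simps sum.distrib flip: exp_add)

lemma fourier_term_ext_mode:
  "fourier_term \<omega> a t y \<alpha> = ext_mode \<omega> y (ext_index \<alpha>) *s a \<alpha> t"
proof -
  have "mdot (ext_index \<alpha>) (ext_state \<omega> y) = (\<Sum>l\<in>UNIV. \<omega> $ l * mdot (\<alpha> $ l) y)"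
    unfolding mdot_def sum_ext_UNIV sum_distrib_left
    by (intro sum.cong refl) (simp add: ext_index_def ext_state_def ext_sign_def algebra_simps)
  then show ?thesis by (simp add: fourier_term_def ext_mode_def)
qed

lemma norm_ext_mode_le:
  assumes "\<And>p. \<bar>Im (ext_state \<omega> y $ p)\<bar> \<le> M" and "msize \<gamma> = int k"
  shows "norm (ext_mode \<omega> y \<gamma>) \<le> exp M ^ k"
proof -
  have "- Im (mdot \<gamma> (ext_state \<omega> y)) = (\<Sum>p\<in>UNIV. - (of_int (\<gamma> $ p) * Im (ext_state \<omega> y $ p)))"
    by (simp add: mdot_def sum_negf)
  also have "\<dots> \<le> (\<Sum>p\<in>UNIV. of_int \<bar>\<gamma> $ p\<bar> * M)"
  proof (rule sum_mono)
    fix p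
    have "- (of_int (\<gamma> $ p) * Im (ext_state \<omega> y $ p)) \<le> \<bar>of_int (\<gamma> $ p) * Im (ext_state \<omega> y $ p)\<bar>"
      by simp
    also have "\<dots> \<le> of_int \<bar>\<gamma> $ p\<bar> * M"
      unfolding abs_mult of_int_abs by (intro mult_left_mono assms) simp
    finally show "- (of_int (\<gamma> $ p) * Im (ext_state \<omega> y $ p)) \<le> of_int \<bar>\<gamma> $ p\<bar> * M" .
  qed
  also have "\<dots> = of_int (msize \<gamma>) * M" by (simp add: msize_def sum_distrib_right)
  also have "\<dots> = real k * M" by (simp add: assms)
  finally show ?thesis by (simp add: ext_mode_def exp_of_nat_mult[symmetric])
qed

lemma cf_entry_ext_index:
  "cf_entry \<omega> a t \<gamma> (\<gamma> + ext_index \<alpha>) = \<i> * mdot \<gamma> (ext_state \<omega> (a \<alpha> t))"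
  by (simp add: cf_entry_def ext_coeff_ext_index mdot_def)

lemma sum_norm_ext_state:
  "(\<Sum>p\<in>UNIV. norm (ext_state \<omega> y $ p)) = 2 * (\<Sum>l\<in>UNIV. norm (\<omega> $ l)) * (\<Sum>j\<in>UNIV. norm (y $ j))"
  unfolding sum_ext_UNIV
  by (subst sum_product[symmetric] | simp add: ext_state_def ext_sign_def norm_mult sum_distrib_left[symmetric] sum_distrib_right[symmetric] mult.assoc)+

lemma norm_mdot_le: "norm (mdot \<gamma> z) \<le> of_int (msize \<gamma>) * (\<Sum>p\<in>UNIV. norm (z $ p))"
proof -
  have "norm (mdot \<gamma> z) \<le> (\<Sum>p\<in>UNIV. \<bar>of_int (\<gamma> $ p)\<bar> * norm (z $ p))"
    unfolding mdot_def by (rule order_trans[OF norm_sum]) (simp add: norm_mult)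
  also have "\<dots> \<le> (\<Sum>p\<in>UNIV. of_int (msize \<gamma>) * norm (z $ p))"
    using msize_nth_le[of \<gamma>] by (intro sum_mono mult_right_mono) (auto simp flip: of_int_abs)
  finally show ?thesis by (simp add: sum_distrib_left)
qed

text \<open>
  The row sums of the block \<open>B\<^sub>k\<^sub>,\<^sub>k\<^sub>+\<^sub>n\<close> are at most \<open>k D / R\<^sup>n\<close>: the weights
  \<open>\<gamma>\<^sub>j\<close> are bounded by \<open>k\<close>, and the factor \<open>2 (\<Sum>\<^sub>l |\<omega>\<^sub>l|)\<close> that the
  extended state introduces cancels the one in the decay condition.
\<close>

lemma cf_entry_level_le:
  assumes decay: "coeff_decay \<omega> a D R" and \<omega>: "\<forall>l. \<omega> $ l \<noteq> 0" and t: "t \<ge> 0"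
    and \<gamma>: "msize \<gamma> = int k"
  shows "(\<Sum>\<alpha> | index_degree \<alpha> = n. norm (cf_entry \<omega> a t \<gamma> (\<gamma> + ext_index \<alpha>))) \<le> real k * D / R ^ n"
proof -
  let ?W = "\<Sum>l\<in>UNIV. norm (\<omega> $ l)"
  have W: "?W > 0" using \<omega> by (intro sum_pos) auto
  have "(\<Sum>\<alpha> | index_degree \<alpha> = n. norm (cf_entry \<omega> a t \<gamma> (\<gamma> + ext_index \<alpha>)))
      \<le> (\<Sum>\<alpha> | index_degree \<alpha> = n. real k * (2 * ?W * (\<Sum>j\<in>UNIV. norm (a \<alpha> t $ j))))"
    unfolding cf_entry_ext_index norm_mult sum_norm_ext_state[symmetric]
    by (rule sum_mono) (use norm_mdot_le[of \<gamma>] \<gamma> in simp)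
  also have "\<dots> = real k * (2 * ?W * (\<Sum>j\<in>UNIV. \<Sum>\<alpha> | index_degree \<alpha> = n. norm (a \<alpha> t $ j)))"
    by (simp only: sum_distrib_left[symmetric] sum.swap[of _ UNIV])
  also have "\<dots> \<le> real k * (2 * ?W * (D / (2 * ?W * R ^ n)))"
    using decay t W unfolding coeff_decay_def index_degree_level
    by (intro mult_left_mono) auto
  also have "\<dots> = real k * D / R ^ n" using W by simp
  finally show ?thesis .
qed

lemma norm_le_sum_norm_cart:
  fixes z :: "'a::real_normed_vector ^ 'i"
  shows "norm z \<le> (\<Sum>i\<in>UNIV. norm (z $ i))"
  unfolding norm_vec_def by (rule order_trans[OF L2_set_le_sum_abs]) simp

lemma norm_fourier_term_le:
  assumes y: "\<And>p. \<bar>Im (ext_state \<omega> y $ p)\<bar> \<le> M"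
  shows "norm (fourier_term \<omega> a t y \<alpha>) \<le> exp M ^ index_degree \<alpha> * (\<Sum>j\<in>UNIV. norm (a \<alpha> t $ j))"
proof -
  have "norm (fourier_term \<omega> a t y \<alpha>) \<le> (\<Sum>j\<in>UNIV. norm (fourier_term \<omega> a t y \<alpha> $ j))"
    by (rule norm_le_sum_norm_cart)
  also have "\<dots> = norm (ext_mode \<omega> y (ext_index \<alpha>)) * (\<Sum>j\<in>UNIV. norm (a \<alpha> t $ j))"
    by (simp add: fourier_term_ext_mode norm_mult sum_distrib_left)
  also have "\<dots> \<le> exp M ^ index_degree \<alpha> * (\<Sum>j\<in>UNIV. norm (a \<alpha> t $ j))"
    by (intro mult_right_mono norm_ext_mode_le[OF y] sum_nonneg) (auto simp: msize_ext_index)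
  finally show ?thesis .
qed

text \<open>
  On a strip of half-width \<open>M < ln R\<close> the terms of level \<open>k\<close> add up to at most a multiple
  of \<open>(e\<^sup>M / R)\<^sup>k\<close>. The Fourier form determines the vector field only where the series converges.
\<close>

lemma fourier_summable:
  assumes decay: "coeff_decay \<omega> a D R" and "t \<ge> 0" "R > 0"
    and y: "\<And>p. \<bar>Im (ext_state \<omega> y $ p)\<bar> \<le> M" and M: "exp M < R"
  shows "fourier_term \<omega> a t y summable_on UNIV"
proof -
  let ?W = "\<Sum>l\<in>UNIV. norm (\<omega> $ l)"
  have "(\<lambda>\<alpha>. norm (fourier_term \<omega> a t y \<alpha>)) summable_on {\<alpha>. 0 \<le> index_degree \<alpha>}"
  proof (rule level_sum_bound)
    fix k
    have "(\<Sum>\<alpha> | index_degree \<alpha> = k. norm (fourier_term \<omega> a t y \<alpha>))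
        \<le> (\<Sum>\<alpha> | index_degree \<alpha> = k. exp M ^ k * (\<Sum>j\<in>UNIV. norm (a \<alpha> t $ j)))"
      using norm_fourier_term_le[OF y] by (intro sum_mono) fastforce
    also have "\<dots> = exp M ^ k * (\<Sum>j\<in>UNIV. \<Sum>\<alpha> | index_degree \<alpha> = k. norm (a \<alpha> t $ j))"
      by (simp only: sum_distrib_left[symmetric] sum.swap[of _ UNIV])
    also have "\<dots> \<le> exp M ^ k * (D / (2 * ?W * R ^ k))"
      using decay \<open>t \<ge> 0\<close> unfolding coeff_decay_def index_degree_level by (intro mult_left_mono) auto
    also have "\<dots> = D / (2 * ?W) * (exp M / R) ^ k" by (simp add: power_divide)
    finally show "(\<Sum>\<alpha> | index_degree \<alpha> = k. norm (fourier_term \<omega> a t y \<alpha>)) \<le> D / (2 * ?W) * (exp M / R) ^ k" .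
  qed (use M \<open>R > 0\<close> in \<open>auto simp: finite_index_degree\<close>)
  then show ?thesis by (auto intro!: abs_summable_summable)
qed

lemma mode_coupling_level_sum:
  assumes decay: "coeff_decay \<omega> a D R" and \<omega>: "\<forall>l. \<omega> $ l \<noteq> 0" and t: "t \<ge> 0" and R: "R > 0"
    and \<gamma>: "msize \<gamma> = int k"
    and y: "\<And>p. \<bar>Im (ext_state \<omega> y $ p)\<bar> \<le> M"
  shows "(\<Sum>\<alpha> | index_degree \<alpha> = n. norm (cf_entry \<omega> a t \<gamma> (\<gamma> + ext_index \<alpha>) * ext_mode \<omega> y (ext_index \<alpha>)))
    \<le> real k * D * (exp M / R) ^ n"
proof -
  have "(\<Sum>\<alpha> | index_degree \<alpha> = n. norm (cf_entry \<omega> a t \<gamma> (\<gamma> + ext_index \<alpha>) * ext_mode \<omega> y (ext_index \<alpha>)))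
      \<le> (\<Sum>\<alpha> | index_degree \<alpha> = n. norm (cf_entry \<omega> a t \<gamma> (\<gamma> + ext_index \<alpha>)) * exp M ^ n)"
    unfolding norm_mult
    by (intro sum_mono mult_left_mono norm_ext_mode_le y) (auto simp: msize_ext_index)
  also have "\<dots> \<le> real k * D / R ^ n * exp M ^ n"
    unfolding sum_distrib_right[symmetric]
    by (intro mult_right_mono cf_entry_level_le assms) auto
  finally show ?thesis by (simp add: power_divide)
qed

text \<open>
  Applies the complex linear functional \<open>z \<mapsto> i \<gamma> z\<close> of the extended state to the Fourier series of the vector
  field. Multiplied by the mode of index \<open>\<gamma>\<close>, this is the row of index \<open>\<gamma>\<close> of the infinite
  Carleman-Fourier system.
\<close>

lemma mode_rate_expansion:
  assumes form: "has_fourier_form \<omega> a g"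
    and decay: "coeff_decay \<omega> a D R" and t: "t \<ge> 0" and R: "R > 0"
    and y: "\<And>p. \<bar>Im (ext_state \<omega> y $ p)\<bar> \<le> M" and M: "exp M < R"
  shows "((\<lambda>\<alpha>. cf_entry \<omega> a t \<gamma> (\<gamma> + ext_index \<alpha>) * ext_mode \<omega> y (ext_index \<alpha>))
            has_sum \<i> * mdot \<gamma> (ext_state \<omega> (g t y))) UNIV"
proof -
  let ?h = "\<lambda>z. \<i> * mdot \<gamma> (ext_state \<omega> z)"
  have "linear ?h"
    using linear_compose[OF linear_compose[OF linear_ext_state linear_mdot]
        bounded_linear.linear[OF bounded_linear_mult_right[of \<i>]]]
    by (simp add: o_def)
  then have "bounded_linear ?h" by (simp only: linear_conv_bounded_linear)
  moreover have "(fourier_term \<omega> a t y has_sum g t y) UNIV"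
    using form fourier_summable[OF decay t R y M] t unfolding has_fourier_form_def by blast
  ultimately have "((\<lambda>\<alpha>. ?h (fourier_term \<omega> a t y \<alpha>)) has_sum ?h (g t y)) UNIV"
    by (rule has_sum_bounded_linear)
  moreover have "?h (fourier_term \<omega> a t y \<alpha>)
      = cf_entry \<omega> a t \<gamma> (\<gamma> + ext_index \<alpha>) * ext_mode \<omega> y (ext_index \<alpha>)" for \<alpha>
    unfolding fourier_term_ext_mode cf_entry_ext_index
    by (auto simp: mdot_def ext_state_def sum_distrib_left sum_distrib_right intro!: sum.cong)
  ultimately show ?thesis by simp
qed

lemma norm_mode_tail_le:
  assumes decay: "coeff_decay \<omega> a D R" and \<omega>: "\<forall>l. \<omega> $ l \<noteq> 0" and t: "t \<ge> 0" and R: "R > 0"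
    and \<gamma>: "msize \<gamma> = int k"
    and y: "\<And>p. \<bar>Im (ext_state \<omega> y $ p)\<bar> \<le> M" and M: "exp M < R"
    and sum: "((\<lambda>\<alpha>. cf_entry \<omega> a t \<gamma> (\<gamma> + ext_index \<alpha>) * ext_mode \<omega> y (ext_index \<alpha>))
            has_sum S) {\<alpha>. n \<le> index_degree \<alpha>}"
  shows "norm S \<le> real k * D * (exp M / R) ^ n / (1 - exp M / R)"
proof -
  let ?\<phi> = "\<lambda>\<alpha>. norm (cf_entry \<omega> a t \<gamma> (\<gamma> + ext_index \<alpha>) * ext_mode \<omega> y (ext_index \<alpha>))"
  have q: "0 \<le> exp M / R" "exp M / R < 1" using M R by auto
  note * = level_sum_bound[of ?\<phi> index_degree, OF norm_ge_zero finite_index_degree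
    mode_coupling_level_sum[OF decay \<omega> t R \<gamma> y] q]
  have "norm S \<le> infsum ?\<phi> {\<alpha>. n \<le> index_degree \<alpha>}"
    using *(1) sum by (intro norm_has_sum_bound[OF has_sum_infsum]) auto
  also note *(2)
  finally show ?thesis .
qed

lemma abs_Im_le_max_Im: "\<bar>Im (ext_state \<omega> x $ p)\<bar> \<le> max_Im \<omega> x"
proof (cases p)
  case (fields m l j)
  have "\<bar>Im (\<omega> $ l * x $ j)\<bar> \<le> (MAX j. \<bar>Im (\<omega> $ l * x $ j)\<bar>)"
    by (intro Max_ge) auto
  also have "\<dots> \<le> max_Im \<omega> x" unfolding max_Im_def by (intro Max_ge) auto
  also have "ext_state \<omega> x $ p = \<omega> $ l * x $ j \<or> ext_state \<omega> x $ p = - (\<omega> $ l * x $ j)"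
    by (simp add: fields ext_state_def ext_sign_def)
  then have "\<bar>Im (\<omega> $ l * x $ j)\<bar> = \<bar>Im (ext_state \<omega> x $ p)\<bar>"
    by (metis abs_minus_cancel uminus_complex.sel(2))
  finally show ?thesis .
qed

lemma mdot_axis: "mdot (axis p 1) z = z $ p"
proof -
  have "mdot (axis p 1) z = (\<Sum>j\<in>UNIV. if j = p then z $ j else 0)"
    unfolding mdot_def by (intro sum.cong) (auto simp: axis_def)
  then show ?thesis by simp
qed

lemma axis_Zplus: "axis p 1 \<in> Zplus 1"
proof -
  have "msize (axis p 1 :: int ^ 'a) = (\<Sum>j\<in>UNIV. if j = p then 1 else 0)"
    unfolding msize_def by (intro sum.cong) (auto simp: axis_def)
  then show ?thesis by (auto simp: Zplus_def axis_def)
qed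

lemma has_vector_derivative_linear:
  fixes h :: "'a::euclidean_space \<Rightarrow> 'b::real_normed_vector"
  assumes "linear h" and "(f has_vector_derivative f') F"
  shows "((\<lambda>s. h (f s)) has_vector_derivative h f') F"
  using assms bounded_linear.has_vector_derivative linear_conv_bounded_linear by metis

text \<open>
  As long as the imaginary parts do not exceed \<open>ln R - 1\<close>, the ratio \<open>e\<^sup>M / R\<close> is at most
  \<open>1 / e\<close> and the geometric series bounds their speed by \<open>D / (1 - 1 / e)\<close>. The hypothesis on
  \<open>T\<close> says that at this speed they cannot leave the strip before \<open>T\<close>, so the comparison
  principle closes the circle.
\<close>

lemma imaginary_part_growth:
  assumes \<omega>: "\<forall>l. \<omega> $ l \<noteq> 0" and D: "D > 0" and R: "R > 0"
    and form: "has_fourier_form \<omega> a g" and decay: "coeff_decay \<omega> a D R"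
    and sol: "solves_on g x0 T x"
    and T: "max_Im \<omega> x0 + D * exp 1 / (exp 1 - 1) * T < ln R - 1"
    and t: "t \<in> {0..T}"
  shows "\<bar>Im (ext_state \<omega> (x t) $ p)\<bar> \<le> max_Im \<omega> x0 + D * exp 1 / (exp 1 - 1) * t"
proof -
  define c where "c = D * exp 1 / (exp (1::real) - 1)"
  have c: "c > 0" using D by (simp add: c_def)
  \<comment> \<open>The comparison principle wants a strict initial gap; the room left at time \<open>T\<close> is used for it.\<close>
  define \<epsilon> where "\<epsilon> = ln R - 1 - (max_Im \<omega> x0 + c * T)"
  have \<epsilon>: "\<epsilon> > 0" using T by (simp add: \<epsilon>_def c_def)
  have init: "\<bar>Im (ext_state \<omega> (x 0) $ p)\<bar> \<le> max_Im \<omega> x0" for p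
    using abs_Im_le_max_Im sol by (metis solves_on_def)
  have "norm (Im (ext_state \<omega> (x t) $ p) - Im (ext_state \<omega> (x 0) $ p))
     \<le> (max_Im \<omega> x0 + \<epsilon> + c * t) - (max_Im \<omega> x0 + \<epsilon> + c * 0)"
  proof (rule first_touch_bound[where I = UNIV and T = T
        and f = "\<lambda>p s. Im (ext_state \<omega> (x s) $ p)" and f' = "\<lambda>p s. Im (ext_state \<omega> (g s (x s)) $ p)"
        and U = "\<lambda>p s. max_Im \<omega> x0 + \<epsilon> + c * s" and U' = "\<lambda>p s. c"])
    fix p s assume s: "s \<in> {0..T}"
    show "((\<lambda>s. Im (ext_state \<omega> (x s) $ p)) has_vector_derivative
        Im (ext_state \<omega> (g s (x s)) $ p)) (at s within {0..T})"
      using sol s by (intro has_vector_derivative_linear[OF linear_Im_ext_state]) (auto simp: solves_on_def)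
    show "((\<lambda>s. max_Im \<omega> x0 + \<epsilon> + c * s) has_vector_derivative c) (at s within {0..T})"
      by (auto intro!: derivative_eq_intros)
    assume below: "\<And>p. p \<in> UNIV \<Longrightarrow> norm (Im (ext_state \<omega> (x s) $ p)) \<le> max_Im \<omega> x0 + \<epsilon> + c * s"
    have s0: "s \<ge> 0" using s by auto
    have y: "\<bar>Im (ext_state \<omega> (x s) $ p)\<bar> \<le> ln R - 1" for p
    proof -
      have "\<bar>Im (ext_state \<omega> (x s) $ p)\<bar> \<le> max_Im \<omega> x0 + \<epsilon> + c * s" using below by simp
      also have "\<dots> \<le> max_Im \<omega> x0 + \<epsilon> + c * T" using c s by simp
      finally show ?thesis by (simp add: \<epsilon>_def)
    qed
    have q: "exp (ln R - 1) / R = inverse (exp 1)" using R by (simp add: exp_diff inverse_eq_divide)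
    have M: "exp (ln R - 1) < R" using R by (simp add: exp_diff field_simps)
    \<comment> \<open>A unit vector \<open>\<gamma>\<close> has \<open>k = 1\<close> and picks out one coordinate; the tail from degree \<open>0\<close> is the whole series.\<close>
    have "norm (\<i> * mdot (axis p 1) (ext_state \<omega> (g s (x s))))
        \<le> real 1 * D * (exp (ln R - 1) / R) ^ 0 / (1 - exp (ln R - 1) / R)"
      by (rule norm_mode_tail_le[OF decay \<omega> s0 R _ y M])
        (use mode_rate_expansion[OF form decay s0 R y M] axis_Zplus[of p] in \<open>auto simp: Zplus_def\<close>)
    also have "\<dots> = c" unfolding q c_def by (simp add: field_simps)
    finally have "norm (ext_state \<omega> (g s (x s)) $ p) \<le> c" by (simp add: mdot_axis norm_mult)
    then show "norm (Im (ext_state \<omega> (g s (x s)) $ p)) \<le> c"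
      using abs_Im_le_cmod order_trans by (metis real_norm_def)
  next
    show "norm (Im (ext_state \<omega> (x 0) $ p)) < max_Im \<omega> x0 + \<epsilon> + c * 0" for p
      using init[of p] \<epsilon> by simp
  qed (use t in auto)
  then have "\<bar>Im (ext_state \<omega> (x t) $ p) - Im (ext_state \<omega> (x 0) $ p)\<bar> \<le> c * t" by simp
  then show ?thesis using init[of p] unfolding c_def[symmetric] by linarith
qed

section \<open>The truncation error\<close>

text \<open>
  An entry \<open>(\<gamma>, \<delta>)\<close> vanishes unless \<open>\<delta> - \<gamma>\<close> is the extended index of some
  \<open>\<alpha>\<close>, and then the sizes force \<open>\<alpha>\<close> to have degree \<open>n\<close>. This brings the blocks into
  the same form as the Fourier expansion.
\<close>

lemma cf_entry_block_sum:
  assumes \<gamma>: "\<gamma> \<in> Zplus k"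
  shows "(\<Sum>\<delta>\<in>Zplus (k + n). cf_entry \<omega> a t \<gamma> \<delta> * V \<delta>)
       = (\<Sum>\<alpha> | index_degree \<alpha> = n. cf_entry \<omega> a t \<gamma> (\<gamma> + ext_index \<alpha>) * V (\<gamma> + ext_index \<alpha>))"
proof -
  let ?s = "\<lambda>\<alpha>. \<gamma> + ext_index \<alpha>"
  have inj: "inj_on ?s {\<alpha>. index_degree \<alpha> = n}"
    using inj_ext_index by (auto simp: inj_on_def)
  have sub: "?s ` {\<alpha>. index_degree \<alpha> = n} \<subseteq> Zplus (k + n)"
    using add_ext_index_Zplus[OF \<gamma>] by auto
  have "cf_entry \<omega> a t \<gamma> \<delta> = 0" if \<delta>: "\<delta> \<in> Zplus (k + n) - ?s ` {\<alpha>. index_degree \<alpha> = n}" for \<delta>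
  proof -
    have "\<delta> - \<gamma> \<noteq> ext_index \<alpha>" for \<alpha>
    proof
      assume "\<delta> - \<gamma> = ext_index \<alpha>"
      then have eq: "\<delta> = ?s \<alpha>" by (simp add: algebra_simps)
      then have "\<delta> \<in> Zplus (k + index_degree \<alpha>)" using add_ext_index_Zplus[OF \<gamma>] by simp
      then have "index_degree \<alpha> = n" using \<delta> by (simp add: Zplus_def)
      then show False using \<delta> eq by blast
    qed
    then show ?thesis by (simp add: cf_entry_def ext_coeff_def)
  qed
  then have "(\<Sum>\<delta>\<in>Zplus (k + n). cf_entry \<omega> a t \<gamma> \<delta> * V \<delta>)
      = (\<Sum>\<delta>\<in>?s ` {\<alpha>. index_degree \<alpha> = n}. cf_entry \<omega> a t \<gamma> \<delta> * V \<delta>)"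
    by (intro sum.mono_neutral_right finite_Zplus sub) auto
  then show ?thesis by (simp add: sum.reindex[OF inj])
qed

text \<open>
  Splitting the expansion of the exact mode at degree \<open>N - k\<close> separates the terms that the finite
  section reproduces, up to the errors of its components, from the discarded tail. Measuring block
  \<open>l\<close> in units of \<open>R\<^sup>l\<close> absorbs the decay of the blocks, and all the blocks
  \<open>l \<ge> k\<close> enter with the same weight \<open>k D\<close>.
\<close>

lemma section_error_rate:
  fixes \<omega> :: "complex ^ 'l" and g :: "real \<Rightarrow> complex ^ 'd \<Rightarrow> complex ^ 'd"
  assumes \<omega>: "\<forall>l. \<omega> $ l \<noteq> 0" and D: "D \<ge> 0" and R: "R > 0"
    and form: "has_fourier_form \<omega> a g" and decay: "coeff_decay \<omega> a D R" and t: "t \<ge> 0"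
    and y: "\<And>p. \<bar>Im (ext_state \<omega> y $ p)\<bar> \<le> M" and M: "exp M < R"
    and \<gamma>: "\<gamma> \<in> Zplus k" and k: "k \<le> N"
    and V: "\<And>l \<delta>. l \<in> {k..N} \<Longrightarrow> \<delta> \<in> Zplus l \<Longrightarrow> norm (V l \<delta> - ext_mode \<omega> y \<delta>) \<le> R ^ l * u l"
    and u: "\<And>l. l \<in> {k..N} \<Longrightarrow> u l \<ge> 0"
  shows "norm ((\<Sum>l=k..N. \<Sum>\<delta>\<in>Zplus l. cf_entry \<omega> a t \<gamma> \<delta> * V l \<delta>)
            - \<i> * mdot \<gamma> (ext_state \<omega> (g t y)) * ext_mode \<omega> y \<gamma>)
       \<le> real k * D * R ^ k * ((\<Sum>l=k..N. u l) + (exp M / R) ^ Suc N / (1 - exp M / R))"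
proof -
  let ?c = "\<lambda>\<alpha>. cf_entry \<omega> a t \<gamma> (\<gamma> + ext_index \<alpha>)"
  let ?e = "\<lambda>\<alpha>. ext_mode \<omega> y (ext_index \<alpha>)"
  let ?q = "exp M / R"
  let ?S = "\<i> * mdot \<gamma> (ext_state \<omega> (g t y))"
  have q: "0 \<le> ?q" "?q < 1" using M R by auto
  have \<gamma>': "msize \<gamma> = int k" using \<gamma> by (simp add: Zplus_def)
  define A where "A = (\<Union>l\<in>{k..N}. {\<alpha> :: int ^ 'd ^ 'l. index_degree \<alpha> = l - k})"
  have A: "UNIV - A = {\<alpha>. Suc N - k \<le> index_degree \<alpha>}"
  proof -
    have "\<alpha> \<in> A \<longleftrightarrow> index_degree \<alpha> < Suc N - k" for \<alpha>
      using k by (auto simp: A_def intro!: bexI[of _ "index_degree \<alpha> + k"])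
    then show ?thesis by auto
  qed
  have finA: "finite A" by (auto simp: A_def finite_index_degree)
  have sumA: "sum h A = (\<Sum>l=k..N. \<Sum>\<alpha> | index_degree \<alpha> = l - k. h \<alpha>)" for h :: "_ \<Rightarrow> complex"
    unfolding A_def by (intro sum.UNION_disjoint) (auto simp: finite_index_degree)
  define \<tau> where "\<tau> = ?S - (\<Sum>\<alpha>\<in>A. ?c \<alpha> * ?e \<alpha>)"
  have "((\<lambda>\<alpha>. ?c \<alpha> * ?e \<alpha>) has_sum \<tau>) {\<alpha>. Suc N - k \<le> index_degree \<alpha>}"
    unfolding \<tau>_def A[symmetric]
    by (intro has_sum_Diff mode_rate_expansion[OF form decay t R y M] has_sum_finite finA) auto
  then have tail: "norm \<tau> \<le> real k * D * ?q ^ (Suc N - k) / (1 - ?q)"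
    by (rule norm_mode_tail_le[OF decay \<omega> t R \<gamma>' y M])
  have "(\<Sum>l=k..N. \<Sum>\<delta>\<in>Zplus l. cf_entry \<omega> a t \<gamma> \<delta> * V l \<delta>)
      = (\<Sum>l=k..N. \<Sum>\<alpha> | index_degree \<alpha> = l - k. ?c \<alpha> * V l (\<gamma> + ext_index \<alpha>))"
  proof (rule sum.cong)
    fix l assume "l \<in> {k..N}"
    then show "(\<Sum>\<delta>\<in>Zplus l. cf_entry \<omega> a t \<gamma> \<delta> * V l \<delta>)
      = (\<Sum>\<alpha> | index_degree \<alpha> = l - k. ?c \<alpha> * V l (\<gamma> + ext_index \<alpha>))"
      using cf_entry_block_sum[OF \<gamma>, where n = "l - k" and V = "V l"] by simp
  qed simp
  moreover have "?S * ext_mode \<omega> y \<gamma>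
      = (\<Sum>l=k..N. \<Sum>\<alpha> | index_degree \<alpha> = l - k. ?c \<alpha> * ext_mode \<omega> y (\<gamma> + ext_index \<alpha>)) + \<tau> * ext_mode \<omega> y \<gamma>"
    unfolding sumA[symmetric] by (simp add: \<tau>_def ext_mode_add sum_distrib_right sum_distrib_left algebra_simps)
  ultimately have "(\<Sum>l=k..N. \<Sum>\<delta>\<in>Zplus l. cf_entry \<omega> a t \<gamma> \<delta> * V l \<delta>) - ?S * ext_mode \<omega> y \<gamma>
      = (\<Sum>l=k..N. \<Sum>\<alpha> | index_degree \<alpha> = l - k. ?c \<alpha> * (V l (\<gamma> + ext_index \<alpha>) - ext_mode \<omega> y (\<gamma> + ext_index \<alpha>)))
         - \<tau> * ext_mode \<omega> y \<gamma>"
    by (simp add: sum_subtractf right_diff_distrib)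
  also have "norm \<dots> \<le> (\<Sum>l=k..N. real k * D * R ^ k * u l) + real k * D * R ^ k * (?q ^ Suc N / (1 - ?q))"
  proof (rule order_trans[OF norm_triangle_ineq4 add_mono])
    show "norm (\<Sum>l=k..N. \<Sum>\<alpha> | index_degree \<alpha> = l - k. ?c \<alpha> * (V l (\<gamma> + ext_index \<alpha>) - ext_mode \<omega> y (\<gamma> + ext_index \<alpha>)))
        \<le> (\<Sum>l=k..N. real k * D * R ^ k * u l)"
    proof (rule sum_norm_le)
      fix l assume l: "l \<in> {k..N}"
      have "norm (\<Sum>\<alpha> | index_degree \<alpha> = l - k. ?c \<alpha> * (V l (\<gamma> + ext_index \<alpha>) - ext_mode \<omega> y (\<gamma> + ext_index \<alpha>)))
          \<le> (\<Sum>\<alpha> | index_degree \<alpha> = l - k. norm (?c \<alpha>) * (R ^ l * u l))"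
      proof (rule sum_norm_le)
        fix \<alpha> assume "\<alpha> \<in> {\<alpha> :: int ^ 'd ^ 'l. index_degree \<alpha> = l - k}"
        then have "\<gamma> + ext_index \<alpha> \<in> Zplus l" using add_ext_index_Zplus[OF \<gamma>, of \<alpha>] l by simp
        then show "norm (?c \<alpha> * (V l (\<gamma> + ext_index \<alpha>) - ext_mode \<omega> y (\<gamma> + ext_index \<alpha>)))
            \<le> norm (?c \<alpha>) * (R ^ l * u l)"
          unfolding norm_mult by (intro mult_left_mono V l) auto
      qed
      also have "\<dots> \<le> real k * D / R ^ (l - k) * (R ^ l * u l)"
        unfolding sum_distrib_right[symmetric]
        using u[OF l] R by (intro mult_right_mono cf_entry_level_le[OF decay \<omega> t \<gamma>']) auto
      also have "R ^ l = R ^ (l - k) * R ^ k" using l by (simp flip: power_add)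
      also have "real k * D / R ^ (l - k) * (R ^ (l - k) * R ^ k * u l) = real k * D * R ^ k * u l"
        using R by simp
      finally show "norm (\<Sum>\<alpha> | index_degree \<alpha> = l - k. ?c \<alpha> * (V l (\<gamma> + ext_index \<alpha>) - ext_mode \<omega> y (\<gamma> + ext_index \<alpha>)))
          \<le> real k * D * R ^ k * u l" .
    qed
    have "norm (\<tau> * ext_mode \<omega> y \<gamma>) \<le> real k * D * ?q ^ (Suc N - k) / (1 - ?q) * exp M ^ k"
      unfolding norm_mult
      using q D by (intro mult_mono tail norm_ext_mode_le[OF y \<gamma>']) auto
    also have "exp M ^ k = ?q ^ k * R ^ k" using R by (simp add: power_divide)
    also have "real k * D * ?q ^ (Suc N - k) / (1 - ?q) * (?q ^ k * R ^ k)
        = real k * D * R ^ k * (?q ^ (Suc N - k) * ?q ^ k / (1 - ?q))"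
      by simp
    also have "?q ^ (Suc N - k) * ?q ^ k = ?q ^ Suc N"
      using k by (subst power_add[symmetric]) simp
    finally show "norm (\<tau> * ext_mode \<omega> y \<gamma>) \<le> real k * D * R ^ k * (?q ^ Suc N / (1 - ?q))" .
  qed
  finally show ?thesis by (simp only: distrib_left sum_distrib_left)
qed

lemma ext_mode_has_vector_derivative:
  assumes "(x has_vector_derivative x') (at s within S)"
  shows "((\<lambda>s. ext_mode \<omega> (x s) \<gamma>) has_vector_derivative
           \<i> * mdot \<gamma> (ext_state \<omega> x') * ext_mode \<omega> (x s) \<gamma>) (at s within S)"
proof -
  have inner: "((\<lambda>s. mdot \<gamma> (ext_state \<omega> (x s))) has_vector_derivative mdot \<gamma> (ext_state \<omega> x')) (at s within S)"
    by (intro has_vector_derivative_linear[OF linear_mdot] has_vector_derivative_linear[OF linear_ext_state] assms)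
  have outer: "((\<lambda>z. exp (\<i> * z)) has_field_derivative \<i> * exp (\<i> * z)) (at z within Z)" for z Z
    by (auto intro!: derivative_eq_intros)
  show ?thesis
    using field_vector_diff_chain_within[OF inner outer]
    by (simp add: ext_mode_def o_def mult_ac)
qed

text \<open>
  With the tail bounded by a constant \<open>F\<close>, the scaled block errors are dominated by any solution of
  \<open>u\<^sub>k' = k D (\<Sum>\<^sub>l\<^sub>\<ge>\<^sub>k u\<^sub>l + F)\<close> with positive initial values. A multiple of the
  growing mode \<open>e\<^sup>N\<^sup>D\<^sup>t W\<close> of the eigenvector \<open>W\<close> solves the homogeneous system, and
  subtracting \<open>F\<close> from the last component, which occurs in every sum, accounts for the source.
  The factor \<open>c > 1\<close> makes the last component, where \<open>W\<^sub>N = 1\<close>, positive at time \<open>0\<close>.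
\<close>

lemma finite_section_error:
  fixes \<omega> :: "complex ^ 'l" and g :: "real \<Rightarrow> complex ^ 'd \<Rightarrow> complex ^ 'd"
  assumes \<omega>: "\<forall>l. \<omega> $ l \<noteq> 0" and D: "D > 0" and R: "R > 0"
    and form: "has_fourier_form \<omega> a g" and decay: "coeff_decay \<omega> a D R"
    and sol: "solves_on g x0 T x" and N: "N \<ge> 1" and trunc: "finite_section \<omega> a x0 T N v"
    and t: "t \<in> {0..T}"
    and strip: "\<And>s p. s \<in> {0..t} \<Longrightarrow> \<bar>Im (ext_state \<omega> (x s) $ p)\<bar> \<le> M" and M: "exp M < R"
    and c: "c > 1"
  shows "norm (v 1 t (axis p 1) - ext_mode \<omega> (x t) (axis p 1))
     \<le> R * ((exp M / R) ^ Suc N / (1 - exp M / R)) * c * exp (real N * D * t) * critical_eigenvector N 1"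
proof -
  define F where "F = (exp M / R) ^ Suc N / (1 - exp M / R)"
  have F: "F > 0" using R M by (simp add: F_def)
  define u where "u k s = F * (c * exp (real N * D * s) * critical_eigenvector N k - (if k = N then 1 else 0))"
    for k s
  have eig_pos: "critical_eigenvector N k > 0" if "k \<in> {1..N}" for k
    using that by (simp add: critical_eigenvector_def)
  have eig_N: "critical_eigenvector N N = 1" using N by (simp add: critical_eigenvector_def)
  have u_pos: "u k s > 0" if "k \<in> {1..N}" "s \<ge> 0" for k s
  proof -
    have e: "exp (real N * D * s) \<ge> 1" using that D by simp
    show ?thesis
    proof (cases "k = N")
      case True
      have "1 < c * exp (real N * D * s)" using c e by (metis less_1_mult mult.right_neutral order_le_less)
      then show ?thesis using F True by (simp add: u_def eig_N)
    next
      case False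
      then show ?thesis using F c eig_pos[OF that(1)] by (simp add: u_def)
    qed
  qed
  have u_sum: "real k * ((\<Sum>l=k..N. u l s) + F) = F * c * (real N * exp (real N * D * s)) * critical_eigenvector N k"
    if "k \<in> {1..N}" for k s
  proof -
    have "(\<Sum>l=k..N. u l s) = F * (c * exp (real N * D * s) * (\<Sum>l=k..N. critical_eigenvector N l) - 1)"
      using that by (simp add: u_def sum_subtractf flip: sum_distrib_left)
    then have "real k * ((\<Sum>l=k..N. u l s) + F)
        = F * c * exp (real N * D * s) * (real k * (\<Sum>l=k..N. critical_eigenvector N l))"
      by (simp add: algebra_simps)
    also have "real k * (\<Sum>l=k..N. critical_eigenvector N l) = real N * critical_eigenvector N k"
      using that by (intro sum_critical_eigenvector) auto
    finally show ?thesis by simp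
  qed
  define I where "I = (SIGMA k:{1..N}. (Zplus k :: (int ^ ('d, 'l) ext) set))"
  let ?f = "\<lambda>i s. v (fst i) s (snd i) - ext_mode \<omega> (x s) (snd i)"
  let ?f' = "\<lambda>i s. (\<Sum>l=fst i..N. \<Sum>\<delta>\<in>Zplus l. cf_entry \<omega> a s (snd i) \<delta> * v l s \<delta>)
               - \<i> * mdot (snd i) (ext_state \<omega> (g s (x s))) * ext_mode \<omega> (x s) (snd i)"
  let ?U = "\<lambda>(i :: nat \<times> (int ^ ('d, 'l) ext)) s. R ^ fst i * u (fst i) s"
  let ?U' = "\<lambda>(i :: nat \<times> (int ^ ('d, 'l) ext)) s. R ^ fst i * (F * (c * (real N * D * exp (real N * D * s)) * critical_eigenvector N (fst i)))"
  have sub: "{0..t} \<subseteq> {0..T}" using t by auto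
  have initial: "?f i 0 = 0" if "i \<in> I" for i
    using that trunc sol by (auto simp: I_def finite_section_def solves_on_def ext_mode_def)
  have "norm (?f (1, axis p 1) t - ?f (1, axis p 1) 0) \<le> ?U (1, axis p 1) t - ?U (1, axis p 1) 0"
  proof (rule first_touch_bound[where I = I and T = t and f = ?f and f' = ?f' and U = ?U and U' = ?U'])
    show "finite I" by (auto simp: I_def finite_Zplus)
    fix i s assume i: "i \<in> I" and s: "s \<in> {0..t}"
    obtain k \<gamma> where k: "i = (k, \<gamma>)" "k \<in> {1..N}" "\<gamma> \<in> Zplus k" using i by (auto simp: I_def)
    have sT: "s \<in> {0..T}" using s sub by auto
    show "(?f i has_vector_derivative ?f' i s) (at s within {0..t})"
      unfolding k fst_conv snd_conv
    proof (rule has_vector_derivative_diff)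
      show "((\<lambda>s. v k s \<gamma>) has_vector_derivative
          (\<Sum>l=k..N. \<Sum>\<delta>\<in>Zplus l. cf_entry \<omega> a s \<gamma> \<delta> * v l s \<delta>)) (at s within {0..t})"
        using trunc k sT unfolding finite_section_def
        by (intro has_vector_derivative_within_subset[OF _ sub]) blast
      show "((\<lambda>s. ext_mode \<omega> (x s) \<gamma>) has_vector_derivative
          \<i> * mdot \<gamma> (ext_state \<omega> (g s (x s))) * ext_mode \<omega> (x s) \<gamma>) (at s within {0..t})"
        using sol sT unfolding solves_on_def
        by (intro ext_mode_has_vector_derivative has_vector_derivative_within_subset[OF _ sub]) blast
    qed
    show "(?U i has_vector_derivative ?U' i s) (at s within {0..t})"
      unfolding k fst_conv snd_conv u_def
      by (auto intro!: derivative_eq_intros simp flip: has_real_derivative_iff_has_vector_derivative)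
    assume below: "\<And>j. j \<in> I \<Longrightarrow> norm (?f j s) \<le> ?U j s"
    have "norm (?f' i s) \<le> real k * D * R ^ k * ((\<Sum>l=k..N. u l s) + F)"
      unfolding k fst_conv snd_conv F_def
    proof (rule section_error_rate[OF \<omega> _ R form decay _ strip[OF s] M k(3)])
      fix l and \<delta> :: "int ^ ('d, 'l) ext" assume "l \<in> {k..N}" "\<delta> \<in> Zplus l"
      then show "norm (v l s \<delta> - ext_mode \<omega> (x s) \<delta>) \<le> R ^ l * u l s"
        using below[of "(l, \<delta>)"] k by (auto simp: I_def)
    qed (use D k s in \<open>auto intro!: less_imp_le[OF u_pos]\<close>)
    also have "\<dots> = D * R ^ k * (real k * ((\<Sum>l=k..N. u l s) + F))" by simp
    also have "\<dots> = ?U' i s" unfolding u_sum[OF k(2)] by (simp add: k)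
    finally show "norm (?f' i s) \<le> ?U' i s" .
  next
    fix i assume i: "i \<in> I"
    then show "norm (?f i 0) < ?U i 0"
      unfolding initial[OF i] using R by (auto simp: I_def intro!: mult_pos_pos u_pos)
  next
    show "(1, axis p 1) \<in> I" using N axis_Zplus by (auto simp: I_def)
  qed (use t in auto)
  moreover have "(1, axis p 1) \<in> I" using N axis_Zplus by (auto simp: I_def)
  note initial[OF this]
  moreover have "u 1 0 > 0" using N by (intro u_pos) auto
  then have "R * u 1 t - R * u 1 0 \<le> R * u 1 t" using R by simp
  moreover have "u 1 t \<le> F * (c * exp (real N * D * t) * critical_eigenvector N 1)"
    using F by (simp add: u_def)
  then have "R * u 1 t \<le> R * (F * (c * exp (real N * D * t) * critical_eigenvector N 1))"
    using R by simp
  ultimately show ?thesis unfolding F_def[symmetric] by (simp add: mult.assoc)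
qed

section \<open>Convergence of the Carleman-Fourier linearization\<close>

theorem theorem4p1:
  fixes \<omega> :: "complex ^ 'l"
    and D\<^sub>1 R :: real
    and g :: "real \<Rightarrow> complex ^ 'd \<Rightarrow> complex ^ 'd"
    and a :: "int ^ 'd ^ 'l \<Rightarrow> real \<Rightarrow> complex ^ 'd"
    and x0 :: "complex ^ 'd"
    and x :: "real \<Rightarrow> complex ^ 'd"
    and N :: nat
    and v :: "nat \<Rightarrow> real \<Rightarrow> int ^ ('d, 'l) ext \<Rightarrow> complex"
  assumes "\<forall>l. \<omega> $ l \<noteq> 0"
    and "D\<^sub>1 > 0"
    and "R > 1"
    and "has_fourier_form \<omega> a g"
    and "coeff_decay \<omega> a D\<^sub>1 R"
    and "max_Im \<omega> x0 < ln R - 1"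
    and "solves_on g x0 (T_CF \<omega> x0 D\<^sub>1 R) x"
    and "N \<ge> 1"
    and "finite_section \<omega> a x0 (T_CF \<omega> x0 D\<^sub>1 R) N v"
  shows "C_CF \<omega> x0 R \<le> R\<^sup>2 / (sqrt (2 * pi) * exp 1 * (exp 1 - 1)) \<and>
    (\<forall>m l j. \<forall>t\<in>{0..T_CF \<omega> x0 D\<^sub>1 R}.
      cmod (v 1 t (axis (m, l, j) 1) * exp (- \<i> * ext_sign m * \<omega> $ l * x t $ j) - 1)
        \<le> C_CF \<omega> x0 R * real N powr (- 3 / 2) * exp (D\<^sub>1 * (t - T_CF \<omega> x0 D\<^sub>1 R) * real N))"
proof -
  define E where "E = exp (1::real)"
  have E: "E > 1" by (simp add: E_def)
  define \<mu> where "\<mu> = max_Im \<omega> x0"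
  define T where "T = T_CF \<omega> x0 D\<^sub>1 R"
  define \<kappa> where "\<kappa> = E / (E - 1)"
  have \<kappa>: "\<kappa> > 0" using E by (simp add: \<kappa>_def)
  have gap: "\<mu> < ln R - 1" using assms by (simp add: \<mu>_def)
  have T_eq: "D\<^sub>1 * T = (E - 1) / (2 * E - 1) * (ln R - 1 - \<mu>)"
    using \<open>D\<^sub>1 > 0\<close> by (simp add: T_def T_CF_def E_def \<mu>_def)
  have gap_eq: "ln R - 1 - \<mu> = (\<kappa> + 1) * (D\<^sub>1 * T)"
  proof -
    have "\<kappa> + 1 = (2 * E - 1) / (E - 1)" using E by (simp add: \<kappa>_def field_simps)
    then show ?thesis unfolding T_eq using E by simp
  qed
  \<comment> \<open>The bound for the imaginary parts at time \<open>t\<close>. At \<open>t = T\<close> it is a convex combination of \<open>\<mu>\<close> and \<open>ln R - 1\<close>.\<close>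
  define M_at where "M_at t = \<mu> + \<kappa> * (D\<^sub>1 * t)" for t
  have M_T: "M_at T = (E - 1) / (2 * E - 1) * \<mu> + E / (2 * E - 1) * (ln R - 1)"
    unfolding M_at_def T_eq \<kappa>_def using E by (simp add: divide_simps) (simp add: algebra_simps)
  have T_pos: "D\<^sub>1 * T > 0" unfolding T_eq using E gap by simp
  have M_T_less: "M_at T < ln R - 1" using gap_eq T_pos by (simp add: M_at_def algebra_simps)
  define P where "P = 1 / (sqrt (2 * pi) * (E - 1))"
  have P: "P > 0" using E by (simp add: P_def)
  have C_eq: "C_CF \<omega> x0 R = P * exp (ln R + M_at T)"
  proof -
    have "(3 * E - 1) / (2 * E - 1) * ln R + (E - 1) / (2 * E - 1) * \<mu> - E / (2 * E - 1) = ln R + M_at T"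
      unfolding M_T using E by (simp add: divide_simps) (simp add: algebra_simps)
    then show ?thesis unfolding C_CF_def P_def E_def \<mu>_def by simp
  qed
  have "C_CF \<omega> x0 R \<le> P * exp (2 * ln R - 1)"
    unfolding C_eq using P M_T_less by (intro mult_left_mono) auto
  also have "exp (2 * ln R - 1) = R\<^sup>2 / E"
    using \<open>R > 1\<close> by (simp add: exp_diff E_def exp_double)
  also have "P * (R\<^sup>2 / E) = R\<^sup>2 / (sqrt (2 * pi) * exp 1 * (exp 1 - 1))"
    by (simp add: P_def E_def mult_ac)
  finally have C_le: "C_CF \<omega> x0 R \<le> R\<^sup>2 / (sqrt (2 * pi) * exp 1 * (exp 1 - 1))" .
  have main: "cmod (v 1 t (axis (m, l, j) 1) * exp (- \<i> * ext_sign m * \<omega> $ l * x t $ j) - 1)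
        \<le> C_CF \<omega> x0 R * real N powr (- 3 / 2) * exp (D\<^sub>1 * (t - T) * real N)"
    if t: "t \<in> {0..T}" for m l j t
  proof -
    let ?p = "(m, l, j)"
    let ?w = "ext_mode \<omega> (x t) (axis ?p 1)"
    define M where "M = M_at t"
    \<comment> \<open>With this choice the constant at \<open>t = T\<close> is exactly that of the theorem. It exceeds \<open>1\<close> because \<open>M_at T < ln R - 1\<close>.\<close>
    define c where "c = exp (ln R - 1 - M_at T)"
    have R: "R > 0" using \<open>R > 1\<close> by simp
    have "M_at s \<le> M_at s'" if "s \<le> s'" for s s'
      using that \<kappa> \<open>D\<^sub>1 > 0\<close> by (simp add: M_at_def)
    note mono = this
    have M_le: "M \<le> M_at T" unfolding M_def using t by (intro mono) auto
    have growth: "\<bar>Im (ext_state \<omega> (x s) $ p)\<bar> \<le> M" if "s \<in> {0..t}" for s p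
    proof -
      have "\<bar>Im (ext_state \<omega> (x s) $ p)\<bar> \<le> max_Im \<omega> x0 + D\<^sub>1 * exp 1 / (exp 1 - 1) * s"
        using assms(7) that t M_T_less unfolding T_def[symmetric]
        by (intro imaginary_part_growth[OF assms(1,2) R assms(4,5)])
           (auto simp: M_at_def \<kappa>_def E_def \<mu>_def mult_ac)
      also have "\<dots> = M_at s" by (simp add: M_at_def \<kappa>_def E_def \<mu>_def mult_ac)
      also have "\<dots> \<le> M" unfolding M_def using that by (intro mono) auto
      finally show ?thesis .
    qed
    define q where "q = exp M / R"
    have q_eq: "q = exp (M - ln R)" using R by (simp add: q_def exp_diff)
    have "M - ln R \<le> - 1" using M_le M_T_less by simp
    then have q_le: "q \<le> 1 / E" unfolding q_eq E_def by (simp add: exp_minus[symmetric] flip: inverse_eq_divide)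
    have q0: "q > 0" by (simp add: q_eq)
    have "1 / E < 1" using E by simp
    then have q1: "q < 1" using q_le by linarith
    then have M_less: "exp M < R" using R by (simp add: q_def)
    have err: "norm (v 1 t (axis ?p 1) - ?w)
        \<le> R * (q ^ Suc N / (1 - q)) * c * exp (real N * D\<^sub>1 * t) * critical_eigenvector N 1"
      unfolding q_def
      by (rule finite_section_error[OF assms(1,2) R assms(4,5,7,8,9) _ growth M_less])
         (use t M_T_less in \<open>auto simp: T_def c_def\<close>)
    have w_inv: "?w * exp (- \<i> * ext_sign m * \<omega> $ l * x t $ j) = 1"
      unfolding ext_mode_def mdot_axis by (simp add: ext_state_def mult.assoc flip: exp_add)
    have w_inv_norm: "norm (exp (- \<i> * ext_sign m * \<omega> $ l * x t $ j)) \<le> exp M"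
    proof -
      have "norm (exp (- \<i> * ext_sign m * \<omega> $ l * x t $ j)) = exp (Im (ext_state \<omega> (x t) $ ?p))"
        by (simp add: ext_state_def mult.assoc)
      then show ?thesis using growth[of t ?p] t by simp
    qed
    have "1 - 1 / E \<le> 1 - q" using q_le by simp
    then have "q ^ Suc N / (1 - q) \<le> q ^ Suc N / (1 - 1 / E)"
      using E q0 q1 \<open>1 / E < 1\<close> \<open>1 - 1 / E \<le> 1 - q\<close> by (intro divide_left_mono mult_pos_pos zero_le_power) linarith+
    also have "\<dots> = q ^ Suc N * (E / (E - 1))" using E by (simp add: field_simps)
    finally have F_le: "q ^ Suc N / (1 - q) \<le> q ^ Suc N * (E / (E - 1))" .
    have "cmod (v 1 t (axis ?p 1) * exp (- \<i> * ext_sign m * \<omega> $ l * x t $ j) - 1)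
        = norm (v 1 t (axis ?p 1) - ?w) * norm (exp (- \<i> * ext_sign m * \<omega> $ l * x t $ j))"
      unfolding norm_mult[symmetric] left_diff_distrib w_inv ..
    also have "\<dots> \<le> (R * (q ^ Suc N / (1 - q)) * c * exp (real N * D\<^sub>1 * t) * critical_eigenvector N 1) * exp M"
      by (intro mult_mono err w_inv_norm) (use R q1 q_eq in \<open>auto simp: c_def critical_eigenvector_def\<close>)
    also have "\<dots> \<le> (R * (q ^ Suc N * (E / (E - 1))) * c * exp (real N * D\<^sub>1 * t)
          * (exp (real N) * real N powr (- 3 / 2) / sqrt (2 * pi))) * exp M"
      using R q1 q_eq E
      by (intro mult_right_mono mult_mono F_le critical_eigenvector_one[OF \<open>N \<ge> 1\<close>])
         (auto simp: c_def critical_eigenvector_def)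
    also have "\<dots> = P * (exp (ln R) * q ^ Suc N * E * c * exp (real N * D\<^sub>1 * t) * exp (real N) * exp M)
          * real N powr (- 3 / 2)"
      using R by (simp add: P_def mult_ac)
    also have "exp (ln R) * q ^ Suc N * E * c * exp (real N * D\<^sub>1 * t) * exp (real N) * exp M
        = exp (ln R + real (Suc N) * (M - ln R) + 1 + (ln R - 1 - M_at T) + real N * D\<^sub>1 * t + real N + M)"
      unfolding q_eq E_def c_def by (simp only: exp_add exp_of_nat_mult)
    also have "ln R + real (Suc N) * (M - ln R) + 1 + (ln R - 1 - M_at T) + real N * D\<^sub>1 * t + real N + M
        = real N * ((\<kappa> + 1) * (D\<^sub>1 * (t - T))) + (ln R + M_at T + 2 * (M - M_at T))"
    proof -
      \<comment> \<open>The time \<open>T\<close> is the one at which the exponent that multiplies \<open>N\<close> vanishes.\<close>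
      have "M = ln R - 1 + (\<kappa> + 1) * (D\<^sub>1 * (t - T)) - D\<^sub>1 * t"
        using gap_eq by (simp add: M_def M_at_def algebra_simps)
      then have "real N * (M - ln R + 1 + D\<^sub>1 * t) = real N * ((\<kappa> + 1) * (D\<^sub>1 * (t - T)))" by simp
      then show ?thesis by (simp add: algebra_simps)
    qed
    also have "P * exp (real N * ((\<kappa> + 1) * (D\<^sub>1 * (t - T))) + (ln R + M_at T + 2 * (M - M_at T)))
          * real N powr (- 3 / 2)
        \<le> P * exp (real N * (D\<^sub>1 * (t - T)) + (ln R + M_at T)) * real N powr (- 3 / 2)"
    proof -
      have "D\<^sub>1 * (t - T) \<le> 0" using t \<open>D\<^sub>1 > 0\<close> by (simp add: mult_nonneg_nonpos)
      then have "\<kappa> * (D\<^sub>1 * (t - T)) \<le> 0" using \<kappa> by (simp add: mult_nonneg_nonpos)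
      then have "(\<kappa> + 1) * (D\<^sub>1 * (t - T)) \<le> D\<^sub>1 * (t - T)" by (simp add: distrib_right)
      then have "real N * ((\<kappa> + 1) * (D\<^sub>1 * (t - T))) \<le> real N * (D\<^sub>1 * (t - T))"
        by (intro mult_left_mono) auto
      then show ?thesis using M_le P by (intro mult_right_mono mult_left_mono) auto
    qed
    also have "\<dots> = C_CF \<omega> x0 R * real N powr (- 3 / 2) * exp (D\<^sub>1 * (t - T) * real N)"
      unfolding C_eq exp_add by (simp add: mult_ac)
    finally show ?thesis .
  qed
  show ?thesis using C_le main unfolding T_def by blast
qed

end
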